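(* Let $q\ge 2$, $m\ge 2$ and $0\le n<m$ be integers, let $J=\{j_1,\dots,j_n\}\subset\{1,\dots,m\}$ have $n$ elements, and let $h_i,h_i':\mathbb{Z}_q\to\mathbb{Z}_q$ ($i=1,\dots,m-n-1$) be functions. For any choice of functions $g_j:\mathbb{Z}_q\to\mathbb{Z}_q$ ($j=1,\dots,m-n$) and of one-to-one mappings $\pi_c:\{1,\dots,m-n\}\to\{1,\dots,m\}\setminus J$ (one for each $\mathbf{c}=(c_1,\dots,c_n)\in\mathbb{Z}_q^n$, where $c=\sum_{i=1}^n c_iq^{n-i}$), let $f:\mathbb{Z}_q^m\to\mathbb{Z}_q$ be the function whose restriction to $\mathbf{x}_J=\mathbf{c}$, for each $\mathbf{c}\in\mathbb{Z}_q^n$, is $$f|_{\mathbf{x}_J=\mathbf{c}}=\sum_{i=1}^{m-n-1}h_i(x_{\pi_c(i)})\,h_i'(x_{\pi_c(i+1)})+\sum_{j=1}^{m-n}g_j(x_{\pi_c(j)})+c .$$ For $0\le t<q^{n+1}$ with $t=\sum_{i=1}^{n+1}t_iq^{n+1-i}$, $t_i\in\{0,\dots,q-1\}$, let $$\psi(C_t)=\Big\{\psi\Big(f+\sum_{i=1}^n(d_i+t_i)x_{j_i}+d_{n+1}x_{\pi(1)}+t_{n+1}x_{\pi(m-n)}\Big): d_i\in\mathbb{Z}_q,\ i=1,\dots,n+1\Big\},$$ where $\pi=\pi_c$ whenever $\mathbf{x}_J=\mathbf{c}$. Then the set of codes $\mathcal{C}=\{\psi(C_t): t=0,1,\dots,q^{n+1}-1\}$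 forms $(q^{n+1},q^m)$-CCCs if and only if $h_i$ and $h_i'$ are permutations of $\mathbb{Z}_q$ for every $i=1,\dots,m-n-1$.
   Context: $\mathbb{Z}_q$ is the ring of integers modulo $q$, with elements represented by $0,1,\dots,q-1$; $\xi_q=\exp(2\pi\sqrt{-1}/q)$. $\mathbf{x}_J=(x_{j_1},\dots,x_{j_n})$. The convention "$\pi=\pi_c$ whenever $\mathbf{x}_J=\mathbf{c}$" means that $x_{\pi(1)}$ and $x_{\pi(m-n)}$ denote the functions of $(x_1,\dots,x_m)$ equal to $x_{\pi_c(1)}$ and $x_{\pi_c(m-n)}$, respectively, at points with $\mathbf{x}_J=\mathbf{c}$. Sequence of a function: for $F:\mathbb{Z}_q^m\to\mathbb{Z}_q$, $\psi(F)=(\xi_q^{F_0},\dots,\xi_q^{F_{q^m-1}})$, where $F_x=F(x_1,\dots,x_m)$ and $(x_1,\dots,x_m)$ with $x_j\in\{0,\dots,q-1\}$ is determined by $x=\sum_{j=1}^m x_jq^{j-1}$. Aperiodic correlation: for complex sequences $\mathbf{a},\mathbf{b}$ of length $L$ and an integer $\tau$ with $|\tau|<L$, $\Theta(\mathbf{a},\mathbf{b})(\tau)=\sum_{s=0}^{L-\tau-1}a_s b_{s+\tau}^*$ if $0\le\tau<L$, and $\Theta(\mathbf{a},\mathbf{b})(\tau)=\sum_{s=0}^{L+\tau-1}a_{s-\tau}b_s^*$ if $-L<\tau<0$. A code is an ordered tuple of $M$ complex sequences of length $L$; for codes $\mathbf{C}=(\mathbf{c}^1,\dots,\mathbf{c}^M)$,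 $\mathbf{D}=(\mathbf{d}^1,\dots,\mathbf{d}^M)$ put $\Theta(\mathbf{C},\mathbf{D})(\tau)=\sum_{\ell=1}^M\Theta(\mathbf{c}^\ell,\mathbf{d}^\ell)(\tau)$. Here each code $\psi(C_t)$ is regarded as a tuple of sequences indexed by $(d_1,\dots,d_{n+1})$, in the same order for all $t$. $(M,L)$-CCCs (complete complementary codes): a family of $M$ codes $\mathbf{C}_1,\dots,\mathbf{C}_M$, each consisting of $M$ sequences of length $L$, such that $\Theta(\mathbf{C}_{k_1},\mathbf{C}_{k_2})(\tau)=ML$ if $\tau=0$ and $k_1=k_2$; $=0$ if $0<|\tau|<L$ and $k_1=k_2$; and $=0$ if $|\tau|<L$ and $k_1\ne k_2$. *)

theory Defs
  imports Complex_Main "HOL-Library.FuncSet"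
begin

text \<open>
  \<open>\<int>\<^sub>q\<close> is represented by its canonical representatives \<open>{0..<q}\<close>, with ring operations taken
  modulo \<open>q\<close>; \<open>\<int>\<^sub>q\<^sup>k\<close> is the set of extensional functions on the index set \<open>{1..k}\<close>.
\<close>

abbreviation Zq :: "nat \<Rightarrow> nat set" where
  "Zq q \<equiv> {0..<q}"

abbreviation Zq_vec :: "nat \<Rightarrow> nat \<Rightarrow> (nat \<Rightarrow> nat) set" where
  "Zq_vec q k \<equiv> {1..k} \<rightarrow>\<^sub>E Zq q"

text \<open>
  Two digit orders are in use: positions of a sequence are read with the first coordinate least
  significant, whereas the labels \<open>c\<close> and \<open>t\<close> have the first coordinate most significant.
\<close>

definition lsd_num :: "nat \<Rightarrow> nat \<Rightarrow> (nat \<Rightarrow> nat) \<Rightarrow> nat" where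
  "lsd_num q k v = (\<Sum>j=1..k. v j * q ^ (j - 1))"

definition msd_num :: "nat \<Rightarrow> nat \<Rightarrow> (nat \<Rightarrow> nat) \<Rightarrow> nat" where
  "msd_num q k v = (\<Sum>i=1..k. v i * q ^ (k - i))"

definition lsd_vec :: "nat \<Rightarrow> nat \<Rightarrow> nat \<Rightarrow> nat \<Rightarrow> nat" where
  "lsd_vec q k s = (\<lambda>j\<in>{1..k}. s div q ^ (j - 1) mod q)"

definition msd_vec :: "nat \<Rightarrow> nat \<Rightarrow> nat \<Rightarrow> nat \<Rightarrow> nat" where
  "msd_vec q k s = (\<lambda>i\<in>{1..k}. s div q ^ (k - i) mod q)"

lemma digit_sum: "(\<Sum>j=1..k. (s div q ^ (j - 1) mod q) * q ^ (j - 1)) = s mod q ^ k" for s q :: nat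
proof (induction k)
  case (Suc k)
  then show ?case
    by (simp add: mod_mult2_eq mult.commute[of q])
qed simp

lemma lsd_num_vec:
  assumes "s < q ^ k"
  shows "lsd_num q k (lsd_vec q k s) = s"
  using digit_sum[of s q k] assms by (simp add: lsd_num_def lsd_vec_def)

lemma msd_num_vec:
  assumes "s < q ^ k"
  shows "msd_num q k (msd_vec q k s) = s"
proof -
  have "msd_num q k (msd_vec q k s) = (\<Sum>i=1..k. (s div q ^ (k - i) mod q) * q ^ (k - i))"
    by (simp add: msd_num_def msd_vec_def)
  also have "\<dots> = (\<Sum>j=1..k. (s div q ^ (j - 1) mod q) * q ^ (j - 1))"
    by (rule sum.reindex_bij_witness[of _ "\<lambda>j. k + 1 - j" "\<lambda>i. k + 1 - i"]) auto
  finally show ?thesis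
    using digit_sum[of s q k] assms by simp
qed

lemma right_inverse_unique_on_vec:
  assumes vec: "\<And>s. s < q ^ k \<Longrightarrow> vec s \<in> Zq_vec q k"
    and num: "\<And>s. s < q ^ k \<Longrightarrow> num (vec s) = s"
    and s: "s < q ^ k"
  shows "v \<in> Zq_vec q k \<and> s = num v \<longleftrightarrow> v = vec s"
proof -
  have inj: "inj_on vec {..<q ^ k}"
    by (rule inj_on_inverseI[of _ num]) (simp add: num)
  have img: "vec ` {..<q ^ k} = Zq_vec q k"
  proof (rule card_subset_eq)
    show "finite (Zq_vec q k)" by (rule finite_PiE) simp_all
    show "vec ` {..<q ^ k} \<subseteq> Zq_vec q k" using vec by blast
    show "card (vec ` {..<q ^ k}) = card (Zq_vec q k)"
      by (simp add: card_image[OF inj] card_PiE)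
  qed
  show ?thesis
  proof
    assume v: "v \<in> Zq_vec q k \<and> s = num v"
    then obtain s' where "s' < q ^ k" "v = vec s'"
      using img by blast
    then show "v = vec s" using v num by simp
  next
    assume "v = vec s"
    then show "v \<in> Zq_vec q k \<and> s = num v" using vec[OF s] num[OF s] by simp
  qed
qed

lemma lsd_vec_unique:
  assumes "q > 0" "s < q ^ k"
  shows "v \<in> Zq_vec q k \<and> s = lsd_num q k v \<longleftrightarrow> v = lsd_vec q k s"
proof (rule right_inverse_unique_on_vec[OF _ _ assms(2)])
  show "lsd_vec q k r \<in> Zq_vec q k" for r
    using assms(1) by (simp add: lsd_vec_def)
qed (rule lsd_num_vec)

lemma msd_vec_unique:
  assumes "q > 0" "s < q ^ k"
  shows "v \<in> Zq_vec q k \<and> s = msd_num q k v \<longleftrightarrow> v = msd_vec q k s"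
proof (rule right_inverse_unique_on_vec[OF _ _ assms(2)])
  show "msd_vec q k r \<in> Zq_vec q k" for r
    using assms(1) by (simp add: msd_vec_def)
qed (rule msd_num_vec)

definition xi :: "nat \<Rightarrow> complex" where
  "xi q = exp (2 * complex_of_real pi * \<i> / of_nat q)"

definition psi :: "nat \<Rightarrow> nat \<Rightarrow> ((nat \<Rightarrow> nat) \<Rightarrow> nat) \<Rightarrow> complex list" where
  "psi q m F = map (\<lambda>s. xi q ^ F (lsd_vec q m s)) [0..<q ^ m]"

definition aperiodic_corr :: "complex list \<Rightarrow> complex list \<Rightarrow> int \<Rightarrow> complex" where
  "aperiodic_corr a b \<tau> =
     (if 0 \<le> \<tau> then \<Sum>s<length a - nat \<tau>. a ! s * cnj (b ! (s + nat \<tau>))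
      else \<Sum>s<length a - nat (- \<tau>). a ! (s + nat (- \<tau>)) * cnj (b ! s))"

definition code_corr :: "complex list list \<Rightarrow> complex list list \<Rightarrow> int \<Rightarrow> complex" where
  "code_corr C D \<tau> = (\<Sum>l<length C. aperiodic_corr (C ! l) (D ! l) \<tau>)"

definition is_CCC :: "nat \<Rightarrow> nat \<Rightarrow> complex list list list \<Rightarrow> bool" where
  "is_CCC M L Cs \<longleftrightarrow>
     length Cs = M \<and>
     (\<forall>C \<in> set Cs. length C = M \<and> (\<forall>a \<in> set C. length a = L)) \<and>
     (\<forall>k1 < M. \<forall>k2 < M. \<forall>\<tau>::int. \<bar>\<tau>\<bar> < int L \<longrightarrow>
        code_corr (Cs ! k1) (Cs ! k2) \<tau> =
          (if k1 = k2 \<and> \<tau> = 0 then of_nat (M * L) else 0))"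

text \<open>
  The enumeration \<open>j\<close> lists \<open>J = {j 1, \<dots>, j n}\<close>. At a point \<open>x\<close> the mapping \<open>\<pi> = \<pi>\<^sub>c\<close> is the one
  labelled by the number \<open>c\<close> of the subvector \<open>x\<^sub>J\<close>.
\<close>

definition label :: "nat \<Rightarrow> nat \<Rightarrow> (nat \<Rightarrow> nat) \<Rightarrow> (nat \<Rightarrow> nat) \<Rightarrow> nat" where
  "label q n j x = msd_num q n (\<lambda>i\<in>{1..n}. x (j i))"

definition code_fun ::
  "nat \<Rightarrow> nat \<Rightarrow> nat \<Rightarrow> (nat \<Rightarrow> nat) \<Rightarrow> (nat \<Rightarrow> nat \<Rightarrow> nat) \<Rightarrow> ((nat \<Rightarrow> nat) \<Rightarrow> nat)
    \<Rightarrow> (nat \<Rightarrow> nat) \<Rightarrow> (nat \<Rightarrow> nat) \<Rightarrow> (nat \<Rightarrow> nat) \<Rightarrow> nat" where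
  "code_fun q m n j \<pi> f t d x =
     (f x + (\<Sum>i=1..n. (d i + t i) * x (j i))
       + d (n + 1) * x (\<pi> (label q n j x) 1)
       + t (n + 1) * x (\<pi> (label q n j x) (m - n))) mod q"

text \<open>
  The tuple indexed by \<open>(d\<^sub>1, \<dots>, d\<^sub>n\<^sub>+\<^sub>1)\<close> is listed in lexicographic order; any order that is the same
  for all \<open>t\<close> gives the same correlations.
\<close>

definition code_seq ::
  "nat \<Rightarrow> nat \<Rightarrow> nat \<Rightarrow> (nat \<Rightarrow> nat) \<Rightarrow> (nat \<Rightarrow> nat \<Rightarrow> nat) \<Rightarrow> ((nat \<Rightarrow> nat) \<Rightarrow> nat)
    \<Rightarrow> nat \<Rightarrow> complex list list" where
  "code_seq q m n j \<pi> f t =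
     map (\<lambda>e. psi q m (code_fun q m n j \<pi> f (msd_vec q (n + 1) t) (msd_vec q (n + 1) e)))
       [0..<q ^ (n + 1)]"

end

theory Submission
  imports Defs
begin

text \<open>
  Summing over \<open>d\<close> first keeps only the pairs of points \<open>x\<close>, \<open>y\<close> with \<open>x\<^sub>J = y\<^sub>J = c\<close> and
  \<open>x\<^bsub>\<pi>(1)\<^esub> = y\<^bsub>\<pi>(1)\<^esub>\<close>. For fixed \<open>c\<close>, let \<open>G\<^sub>k(\<tau>, a, b)\<close> be the sum of
  \<open>\<xi>\<close> to the power \<open>f(x) - f(y)\<close>, truncated to the first \<open>k + 1\<close> coordinates along \<open>\<pi>\<^sub>c\<close>, over pairs with
  displacement \<open>\<tau>\<close> whose last coordinates are \<open>a\<close> and \<open>b\<close>. By Fourier inversion in \<open>t\<close>, the codes are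
  complete complementary iff every \<open>G\<^bsub>m-n-1\<^esub>\<close> vanishes off \<open>\<tau> = 0\<close>, \<open>a = b\<close>. The numbers \<open>G\<^bsub>k+1\<^esub>\<close> are
  a two-dimensional character transform of \<open>G\<^sub>k\<close> along \<open>h\<^bsub>k+1\<^esub>\<close>, \<open>h'\<^bsub>k+1\<^esub>\<close>, and uniqueness of signed
  base-\<open>q\<close> digits gives \<open>G\<^sub>k(0, a, b)\<close> unconditionally. Hence \<open>G\<^bsub>k+1\<^esub>\<close> vanishes there iff \<open>G\<^sub>k\<close> does and
  \<open>h\<^bsub>k+1\<^esub>\<close>, \<open>h'\<^bsub>k+1\<^esub>\<close> are permutations: displacements \<open>(b - a) q\<^sup>e\<close>, with \<open>e\<close> the place of the last coordinate, isolate
  the diagonal of \<open>G\<^sub>k\<close> and force the permutations, after which the transform is invertible.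
\<close>

section \<open>Additive characters of the integers modulo q\<close>

text \<open>Integer arguments allow differences of exponents without reduction modulo
  \<open>q\<close>; \<open>chr_cong\<close> restores the dependence on the residue alone.\<close>

definition chr :: "nat \<Rightarrow> int \<Rightarrow> complex" where
  "chr q z = cis (2 * pi * of_int z / of_nat q)"

lemma chr_0 [simp]: "chr q 0 = 1"
  by (simp add: chr_def)

lemma chr_neq_0 [simp]: "chr q z \<noteq> 0"
  by (simp add: chr_def)

lemma chr_add: "chr q (z + w) = chr q z * chr q w"
  by (simp add: chr_def cis_mult add_divide_distrib distrib_left)

lemma cnj_chr: "cnj (chr q z) = chr q (- z)"
  by (simp add: chr_def cis_cnj)

lemma chr_sum: "chr q (\<Sum>i\<in>I. z i) = (\<Prod>i\<in>I. chr q (z i))"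
  by (induction I rule: infinite_finite_induct) (simp_all add: chr_add)

lemma chr_power: "chr q z ^ k = chr q (int k * z)"
  by (induction k) (simp_all add: chr_add distrib_right)

lemma xi_power: "xi q ^ k = chr q (int k)"
proof -
  have "xi q = chr q 1"
    by (simp add: xi_def chr_def cis_conv_exp mult_ac)
  then show ?thesis
    by (simp add: chr_power)
qed

text \<open>The real part decides: a cosine equal to 1 forces the angle to be an integer multiple of
  a full turn.\<close>

lemma chr_eq_1_iff:
  assumes "q > 0"
  shows "chr q z = 1 \<longleftrightarrow> int q dvd z"
proof
  assume "chr q z = 1"
  then have "cos (2 * pi * of_int z / of_nat q) = 1"
    by (metis chr_def cis.sel(1) one_complex.sel(1))
  then obtain k :: int where "2 * pi * of_int z / of_nat q = of_int k * 2 * pi"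
    using cos_one_2pi_int by blast
  then have "real_of_int z = of_int (int q * k)"
    using assms by (simp add: field_simps)
  then show "int q dvd z"
    using of_int_eq_iff dvd_triv_left by metis
next
  assume "int q dvd z"
  then obtain k where "z = int q * k" ..
  then have "chr q z = cis (2 * pi * of_int k)"
    using assms by (simp add: chr_def mult.assoc)
  also have "\<dots> = 1"
    by (rule cis_multiple_2pi) simp
  finally show "chr q z = 1" .
qed

lemma chr_cong:
  assumes "q > 0" "z mod int q = w mod int q"
  shows "chr q z = chr q w"
proof -
  have "int q dvd z - w"
    using assms(2) by (simp add: mod_eq_dvd_iff)
  then have "chr q (z - w) = 1"
    using assms(1) chr_eq_1_iff by blast
  then show ?thesis
    using chr_add[of q "z - w" w] by simp
qed

section \<open>Orthogonality relations and Fourier inversion\<close>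

lemma dvd_diff_Zq_iff:
  assumes "a \<in> Zq q" "b \<in> Zq q"
  shows "int q dvd int a - int b \<longleftrightarrow> a = b"
  using assms by (auto simp: mod_eq_dvd_iff[symmetric] zmod_int[symmetric])

text \<open>A geometric sum whose ratio \<open>chr q z\<close> has \<open>q\<close>-th power 1; it
  vanishes unless the ratio itself is 1.\<close>

lemma sum_chr:
  assumes "q > 0"
  shows "(\<Sum>a\<in>Zq q. chr q (int a * z)) = (if int q dvd z then of_nat q else 0)"
proof (cases "int q dvd z")
  case True
  then have "chr q (int a * z) = 1" for a
    using assms by (simp add: chr_eq_1_iff)
  then show ?thesis
    using True by simp
next
  case False
  have "(1 - chr q z) * (\<Sum>a<q. chr q z ^ a) = 1 - chr q z ^ q"
    by (simp add: one_diff_power_eq)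
  also have "\<dots> = 0"
    using assms by (simp add: chr_power chr_eq_1_iff)
  finally show ?thesis
    using False assms by (simp add: chr_eq_1_iff chr_power atLeast0LessThan)
qed

text \<open>The character of a sum over coordinates is a product, so the sum over vectors factors
  into one-dimensional sums.\<close>

lemma sum_chr_PiE:
  assumes "q > 0" "finite I"
  shows "(\<Sum>t\<in>I \<rightarrow>\<^sub>E Zq q. chr q (\<Sum>i\<in>I. int (t i) * z i)) =
    (if \<forall>i\<in>I. int q dvd z i then of_nat q ^ card I else 0)"
proof -
  have "(\<Sum>t\<in>I \<rightarrow>\<^sub>E Zq q. chr q (\<Sum>i\<in>I. int (t i) * z i)) =
      (\<Prod>i\<in>I. \<Sum>a\<in>Zq q. chr q (int a * z i))"
    using assms(2) by (simp add: chr_sum prod_sum_PiE)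
  also have "\<dots> = (\<Prod>i\<in>I. if int q dvd z i then of_nat q else 0)"
    by (simp add: sum_chr[OF assms(1)])
  also have "\<dots> = (if \<forall>i\<in>I. int q dvd z i then of_nat q ^ card I else 0)"
    using assms(2) by auto
  finally show ?thesis .
qed

text \<open>Multiplying the hypothesis for \<open>t\<close> by the conjugate character at
  \<open>c\<close> and summing over \<open>t\<close> leaves, by orthogonality, a nonzero multiple of
  \<open>K c\<close>.\<close>

lemma fourier_PiE_zeroD:
  assumes "q > 0" "finite I" "c \<in> I \<rightarrow>\<^sub>E Zq q"
    and zero: "\<And>t. t \<in> I \<rightarrow>\<^sub>E Zq q \<Longrightarrow>
      (\<Sum>b\<in>I \<rightarrow>\<^sub>E Zq q. chr q (\<Sum>i\<in>I. int (t i) * int (b i)) * K b) = 0"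
  shows "K c = 0"
proof -
  let ?V = "I \<rightarrow>\<^sub>E Zq q"
  have fin: "finite ?V"
    using assms(2) by (simp add: finite_PiE)
  have "0 = (\<Sum>t\<in>?V. chr q (\<Sum>i\<in>I. int (t i) * - int (c i)) *
      (\<Sum>b\<in>?V. chr q (\<Sum>i\<in>I. int (t i) * int (b i)) * K b))"
    using zero by simp
  also have "\<dots> = (\<Sum>t\<in>?V. \<Sum>b\<in>?V. chr q (\<Sum>i\<in>I. int (t i) * (int (b i) - int (c i))) * K b)"
    by (simp add: sum_distrib_left mult.assoc[symmetric] chr_add[symmetric]
        sum.distrib[symmetric] right_diff_distrib)
  also have "\<dots> = (\<Sum>b\<in>?V. (\<Sum>t\<in>?V. chr q (\<Sum>i\<in>I. int (t i) * (int (b i) - int (c i)))) * K b)"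
    by (subst sum.swap) (simp add: sum_distrib_right)
  also have "\<dots> = (\<Sum>b\<in>?V. if b = c then of_nat q ^ card I * K b else 0)"
  proof (rule sum.cong)
    fix b assume b: "b \<in> ?V"
    have "(\<forall>i\<in>I. int q dvd int (b i) - int (c i)) \<longleftrightarrow> (\<forall>i\<in>I. b i = c i)"
      using dvd_diff_Zq_iff[OF PiE_mem[OF b] PiE_mem[OF assms(3)]] by simp
    also have "\<dots> \<longleftrightarrow> b = c"
      using PiE_ext[OF b assms(3)] by auto
    finally show "(\<Sum>t\<in>?V. chr q (\<Sum>i\<in>I. int (t i) * (int (b i) - int (c i)))) * K b =
        (if b = c then of_nat q ^ card I * K b else 0)"
      by (simp add: sum_chr_PiE[OF assms(1,2)])
  qed simp
  also have "\<dots> = of_nat q ^ card I * K c"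
    using assms(3) fin by simp
  finally show ?thesis
    using assms(1) by simp
qed

text \<open>The same inversion in one variable, with the frequencies relabelled by \<open>h\<close>;
  injectivity keeps the frequencies \<open>h b\<close> distinct modulo \<open>q\<close>.\<close>

lemma fourier_zeroD:
  assumes "q > 0" "u \<in> Zq q" "h \<in> Zq q \<rightarrow> Zq q" "inj_on h (Zq q)"
    and zero: "\<And>t. t \<in> Zq q \<Longrightarrow> (\<Sum>b\<in>Zq q. chr q (int (h b) * int t) * K b) = 0"
  shows "K u = 0"
proof -
  have shift: "chr q (- int (h u) * int t) * (chr q (int (h b) * int t) * K b) =
      chr q (int t * (int (h b) - int (h u))) * K b" for t b
  proof -
    have "int t * (int (h b) - int (h u)) = - int (h u) * int t + int (h b) * int t"
      by (simp add: algebra_simps)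
    then show ?thesis
      by (simp only: chr_add mult.assoc)
  qed
  have "0 = (\<Sum>t\<in>Zq q. chr q (- int (h u) * int t) * (\<Sum>b\<in>Zq q. chr q (int (h b) * int t) * K b))"
    using zero by simp
  also have "\<dots> = (\<Sum>t\<in>Zq q. \<Sum>b\<in>Zq q. chr q (int t * (int (h b) - int (h u))) * K b)"
    by (simp only: sum_distrib_left shift)
  also have "\<dots> = (\<Sum>b\<in>Zq q. (\<Sum>t\<in>Zq q. chr q (int t * (int (h b) - int (h u)))) * K b)"
    by (subst sum.swap) (simp add: sum_distrib_right)
  also have "\<dots> = (\<Sum>b\<in>Zq q. if b = u then of_nat q * K b else 0)"
  proof (rule sum.cong)
    fix b assume b: "b \<in> Zq q"
    have "h b \<in> Zq q" "h u \<in> Zq q"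
      using assms(2,3) b by blast+
    then have "int q dvd int (h b) - int (h u) \<longleftrightarrow> b = u"
      using dvd_diff_Zq_iff inj_on_eq_iff[OF assms(4) b assms(2)] by metis
    then show "(\<Sum>t\<in>Zq q. chr q (int t * (int (h b) - int (h u)))) * K b =
        (if b = u then of_nat q * K b else 0)"
      by (simp add: sum_chr[OF assms(1)])
  qed simp
  also have "\<dots> = of_nat q * K u"
    using assms(2) by simp
  finally show ?thesis
    using assms(1) by simp
qed

lemma fourier2_zeroD:
  assumes "q > 0" "u \<in> Zq q" "w \<in> Zq q" "h \<in> Zq q \<rightarrow> Zq q" "inj_on h (Zq q)"
    and zero: "\<And>s t. s \<in> Zq q \<Longrightarrow> t \<in> Zq q \<Longrightarrow>
      (\<Sum>a\<in>Zq q. \<Sum>b\<in>Zq q. chr q (int (h a) * int s - int (h b) * int t) * K a b) = 0"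
  shows "K u w = 0"
proof -
  have inner: "(\<Sum>b\<in>Zq q. chr q (- (int (h b) * int t)) * K u b) = 0" if t: "t \<in> Zq q" for t
  proof (rule fourier_zeroD[OF assms(1,2,4,5), where K = "\<lambda>a. \<Sum>b\<in>Zq q. chr q (- (int (h b) * int t)) * K a b"])
    fix s assume "s \<in> Zq q"
    from zero[OF this t] show "(\<Sum>a\<in>Zq q. chr q (int (h a) * int s) *
        (\<Sum>b\<in>Zq q. chr q (- (int (h b) * int t)) * K a b)) = 0"
      by (simp add: sum_distrib_left mult.assoc[symmetric] chr_add[symmetric])
  qed
  \<comment> \<open>The second variable enters with a minus sign; conjugating turns it into the form
    that \<open>fourier_zeroD\<close> expects.\<close>
  have "cnj (K u w) = 0"
  proof (rule fourier_zeroD[OF assms(1,3-5), where K = "\<lambda>b. cnj (K u b)"])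
    fix t assume "t \<in> Zq q"
    from arg_cong[OF inner[OF this], of cnj]
    show "(\<Sum>b\<in>Zq q. chr q (int (h b) * int t) * cnj (K u b)) = 0"
      by (simp add: cnj_chr)
  qed
  then show ?thesis
    by simp
qed

text \<open>These exponential sums are what remains of a path correlation when the shorter path has
  displacement zero. A collision of \<open>h'\<close> gives the sum \<open>q\<close>, so
  \<open>h'\<close> is injective; its differences then supply every nonzero frequency, and this
  forces \<open>h\<close> to be onto.\<close>

lemma permutation_pair_iff:
  assumes q: "q > 0" and h: "h \<in> Zq q \<rightarrow> Zq q" and h': "h' \<in> Zq q \<rightarrow> Zq q"
  shows "(\<forall>a\<in>Zq q. \<forall>b\<in>Zq q. a \<noteq> b \<longrightarrow>
            (\<Sum>u\<in>Zq q. chr q (int (h u) * (int (h' a) - int (h' b)))) = 0)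
     \<longleftrightarrow> bij_betw h (Zq q) (Zq q) \<and> bij_betw h' (Zq q) (Zq q)"
proof
  assume *: "\<forall>a\<in>Zq q. \<forall>b\<in>Zq q. a \<noteq> b \<longrightarrow>
            (\<Sum>u\<in>Zq q. chr q (int (h u) * (int (h' a) - int (h' b)))) = 0"
  have "inj_on h' (Zq q)"
  proof (rule inj_onI, rule ccontr)
    fix a b assume ab: "a \<in> Zq q" "b \<in> Zq q" "h' a = h' b" "a \<noteq> b"
    then have "(\<Sum>u\<in>Zq q. chr q (int (h u) * (int (h' a) - int (h' b)))) = 0"
      using * by blast
    then show False
      using ab(3) q by simp
  qed
  then have bij': "bij_betw h' (Zq q) (Zq q)"
    using h' by (simp add: bij_betw_def endo_inj_surj image_subset_iff_funcset)
  have zero: "(\<Sum>u\<in>Zq q. chr q (int (h u) * int d)) = 0" if d: "d \<in> Zq q" "d \<noteq> 0" for d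
  proof -
    \<comment> \<open>A preimage of 0 is taken as second point, so that the difference of the two
      values is exactly \<open>d\<close>.\<close>
    have "d \<in> h' ` Zq q" "0 \<in> h' ` Zq q"
      using bij' d q by (auto simp: bij_betw_def)
    then obtain a b where ab: "a \<in> Zq q" "b \<in> Zq q" "h' a = d" "h' b = 0"
      by (metis imageE)
    then have "a \<noteq> b"
      using d by auto
    then show ?thesis
      using * ab by fastforce
  qed
  have "v \<in> h ` Zq q" if v: "v \<in> Zq q" for v
  proof (rule ccontr)
    assume v': "v \<notin> h ` Zq q"
    \<comment> \<open>The double sum is \<open>q\<close> times the number of preimages of
      \<open>v\<close>, here 0; summed in the other order, only \<open>d = 0\<close> contributes and
      gives \<open>q\<close>.\<close>
    have "(\<Sum>u\<in>Zq q. \<Sum>d\<in>Zq q. chr q (int d * (int (h u) - int v))) = (\<Sum>u\<in>Zq q. 0)"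
    proof (rule sum.cong)
      fix u assume u: "u \<in> Zq q"
      then have "h u \<in> Zq q" "h u \<noteq> v"
        using h v' by blast+
      then show "(\<Sum>d\<in>Zq q. chr q (int d * (int (h u) - int v))) = 0"
        using dvd_diff_Zq_iff v sum_chr[OF q] by simp
    qed simp
    also have "(\<Sum>u\<in>Zq q. \<Sum>d\<in>Zq q. chr q (int d * (int (h u) - int v))) =
        (\<Sum>d\<in>Zq q. chr q (- int v * int d) * (\<Sum>u\<in>Zq q. chr q (int (h u) * int d)))"
      by (subst sum.swap) (simp add: sum_distrib_left chr_add[symmetric] algebra_simps)
    also have "\<dots> = (\<Sum>d\<in>Zq q. if d = 0 then of_nat q else 0)"
      by (rule sum.cong) (use zero in auto)
    finally show False
      using q by simp
  qed
  then have "h ` Zq q = Zq q"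
    using h by blast
  then have "bij_betw h (Zq q) (Zq q)"
    by (simp add: bij_betw_def eq_card_imp_inj_on)
  with bij' show "bij_betw h (Zq q) (Zq q) \<and> bij_betw h' (Zq q) (Zq q)"
    by blast
next
  assume bij: "bij_betw h (Zq q) (Zq q) \<and> bij_betw h' (Zq q) (Zq q)"
  show "\<forall>a\<in>Zq q. \<forall>b\<in>Zq q. a \<noteq> b \<longrightarrow>
            (\<Sum>u\<in>Zq q. chr q (int (h u) * (int (h' a) - int (h' b)))) = 0"
  proof (intro ballI impI)
    fix a b assume ab: "a \<in> Zq q" "b \<in> Zq q" "a \<noteq> b"
    then have "h' a \<in> Zq q" "h' b \<in> Zq q" "h' a \<noteq> h' b"
      using h' bij by (auto simp: bij_betw_def dest: inj_onD)
    then have "\<not> int q dvd int (h' a) - int (h' b)"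
      using dvd_diff_Zq_iff by metis
    then have "(\<Sum>u\<in>Zq q. chr q (int u * (int (h' a) - int (h' b)))) = 0"
      using sum_chr[OF q] by simp
    then show "(\<Sum>u\<in>Zq q. chr q (int (h u) * (int (h' a) - int (h' b)))) = 0"
      using sum.reindex_bij_betw[of h "Zq q" "Zq q" "\<lambda>u. chr q (int u * (int (h' a) - int (h' b)))"] bij
      by simp
  qed
qed

section \<open>Correlations along a path\<close>

text \<open>
  The index \<open>k\<close> counts edges of the path, so \<open>k + 1\<close> coordinates are involved. The summand \<open>g 1\<close> is
  absent because the two paths start at the same value.
\<close>

fun path_corr :: "nat \<Rightarrow> (nat \<Rightarrow> nat) \<Rightarrow> (nat \<Rightarrow> nat \<Rightarrow> nat) \<Rightarrow> (nat \<Rightarrow> nat \<Rightarrow> nat) \<Rightarrow>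
    (nat \<Rightarrow> nat \<Rightarrow> nat) \<Rightarrow> nat \<Rightarrow> int \<Rightarrow> nat \<Rightarrow> nat \<Rightarrow> complex" where
  "path_corr q \<epsilon> h h' g 0 \<tau> a b = (if \<tau> = 0 \<and> a = b then 1 else 0)"
| "path_corr q \<epsilon> h h' g (Suc k) \<tau> a b =
     chr q (int (g (k + 2) a) - int (g (k + 2) b)) *
     (\<Sum>u\<in>Zq q. \<Sum>w\<in>Zq q.
        chr q (int (h (k + 1) u) * int (h' (k + 1) a) - int (h (k + 1) w) * int (h' (k + 1) b)) *
        path_corr q \<epsilon> h h' g k (\<tau> - (int b - int a) * int q ^ \<epsilon> (k + 2)) u w)"

text \<open>The place value of the \<open>i\<close>-th coordinate along the path is
  \<open>q ^ \<epsilon> i\<close>. Here \<open>k\<close> counts vertices, whereas in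
  \<open>path_fun\<close> and \<open>path_corr\<close> it counts edges.\<close>

definition path_pos :: "nat \<Rightarrow> (nat \<Rightarrow> nat) \<Rightarrow> nat \<Rightarrow> (nat \<Rightarrow> nat) \<Rightarrow> int" where
  "path_pos q \<epsilon> k u = (\<Sum>i=1..k. int (u i) * int q ^ \<epsilon> i)"

definition path_fun :: "(nat \<Rightarrow> nat \<Rightarrow> nat) \<Rightarrow> (nat \<Rightarrow> nat \<Rightarrow> nat) \<Rightarrow> (nat \<Rightarrow> nat \<Rightarrow> nat) \<Rightarrow>
    nat \<Rightarrow> (nat \<Rightarrow> nat) \<Rightarrow> nat" where
  "path_fun h h' g k u = (\<Sum>i=1..k. h i (u i) * h' i (u (i + 1))) + (\<Sum>i=1..k + 1. g i (u i))"

lemma sum_Zq_vec_Suc: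
  "(\<Sum>u\<in>Zq_vec q (Suc k). F u) = (\<Sum>a\<in>Zq q. \<Sum>u\<in>Zq_vec q k. F (u(Suc k := a)))"
proof -
  have "Zq_vec q (Suc k) = (\<lambda>(a, u). u(Suc k := a)) ` (Zq q \<times> Zq_vec q k)"
    using PiE_insert_eq[of "Suc k" "{1..k}" "\<lambda>_. Zq q"] by (simp add: atLeastAtMostSuc_conv)
  moreover have "inj_on (\<lambda>(a, u). u(Suc k := a)) (Zq q \<times> Zq_vec q k)"
    by (rule inj_combinator) simp
  ultimately show ?thesis
    by (simp add: sum.reindex sum.cartesian_product case_prod_unfold)
qed

lemma path_pos_upd: "path_pos q \<epsilon> (Suc k) (u(Suc k := a)) = path_pos q \<epsilon> k u + int a * int q ^ \<epsilon> (Suc k)"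
  by (simp add: path_pos_def)

lemma path_fun_upd:
  "path_fun h h' g (Suc k) (u(Suc (Suc k) := a)) =
    path_fun h h' g k u + h (Suc k) (u (Suc k)) * h' (Suc k) a + g (Suc (Suc k)) a"
  by (simp add: path_fun_def)

text \<open>This identifies the recursion \<open>path_corr\<close> with a sum over pairs of paths.
  The weight \<open>T\<close> on the end values is arbitrary because stripping the last coordinate
  turns the last edge into a new weight.\<close>

lemma sum_path_corr:
  assumes q: "q > 0"
  shows "(\<Sum>u\<in>Zq_vec q (Suc k). \<Sum>w\<in>Zq_vec q (Suc k).
      if u 1 = w 1 \<and> path_pos q \<epsilon> (Suc k) w - path_pos q \<epsilon> (Suc k) u = \<tau>
      then chr q (int (path_fun h h' g k u) - int (path_fun h h' g k w)) * T (u (Suc k)) (w (Suc k))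
      else 0) =
    (\<Sum>a\<in>Zq q. \<Sum>b\<in>Zq q. path_corr q \<epsilon> h h' g k \<tau> a b * T a b)"
proof (induction k arbitrary: \<tau> T)
  case 0
  \<comment> \<open>The empty index set admits a single extensional function, with value
    \<open>undefined\<close> everywhere.\<close>
  have V0: "(\<Sum>u\<in>Zq_vec q 0. F u) = F (\<lambda>_. undefined)" for F :: "(nat \<Rightarrow> nat) \<Rightarrow> complex"
    by simp
  show ?case
    unfolding sum_Zq_vec_Suc V0
    by (intro sum.cong) (auto simp: path_pos_def path_fun_def)
next
  case (Suc k)
  let ?V = "Zq_vec q (Suc k)" and ?k = "Suc (Suc k)"
  let ?\<tau> = "\<lambda>a b. \<tau> - (int b - int a) * int q ^ \<epsilon> ?k"
  \<comment> \<open>\<open>?S\<close> is the contribution of the last edge. It depends on the end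
    values of the shorter paths and so serves as the weight in the induction hypothesis, while
    \<open>?c\<close> factors out.\<close>
  let ?S = "\<lambda>a b u w. chr q (int (h (Suc k) u) * int (h' (Suc k) a) - int (h (Suc k) w) * int (h' (Suc k) b))"
  let ?c = "\<lambda>a b. chr q (int (g ?k a) - int (g ?k b)) * T a b"
  let ?F = "\<lambda>a b u w. if u 1 = w 1 \<and> path_pos q \<epsilon> (Suc k) w - path_pos q \<epsilon> (Suc k) u = ?\<tau> a b
      then chr q (int (path_fun h h' g k u) - int (path_fun h h' g k w)) * ?S a b (u (Suc k)) (w (Suc k))
      else 0"
  let ?G = "\<lambda>u w. if u 1 = w 1 \<and> path_pos q \<epsilon> ?k w - path_pos q \<epsilon> ?k u = \<tau>
      then chr q (int (path_fun h h' g (Suc k) u) - int (path_fun h h' g (Suc k) w)) * T (u ?k) (w ?k)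
      else 0"
  have G: "?G (u(?k := a)) (w(?k := b)) = ?c a b * ?F a b u w" for a b u w
  proof -
    have pos: "path_pos q \<epsilon> ?k (w(?k := b)) - path_pos q \<epsilon> ?k (u(?k := a)) = \<tau> \<longleftrightarrow>
        path_pos q \<epsilon> (Suc k) w - path_pos q \<epsilon> (Suc k) u = ?\<tau> a b"
      unfolding path_pos_upd by (auto simp: algebra_simps)
    have val: "int (path_fun h h' g (Suc k) (u(?k := a))) - int (path_fun h h' g (Suc k) (w(?k := b))) =
        (int (g ?k a) - int (g ?k b)) + (int (path_fun h h' g k u) - int (path_fun h h' g k w)) +
        (int (h (Suc k) (u (Suc k))) * int (h' (Suc k) a) - int (h (Suc k) (w (Suc k))) * int (h' (Suc k) b))"
      unfolding path_fun_upd by simp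
    show ?thesis
      unfolding pos val chr_add by simp
  qed
  have "(\<Sum>u\<in>Zq_vec q ?k. \<Sum>w\<in>Zq_vec q ?k. ?G u w) =
      (\<Sum>a\<in>Zq q. \<Sum>u\<in>?V. \<Sum>b\<in>Zq q. \<Sum>w\<in>?V. ?c a b * ?F a b u w)"
    by (simp only: sum_Zq_vec_Suc[where k = "Suc k"] G)
  also have "\<dots> = (\<Sum>a\<in>Zq q. \<Sum>b\<in>Zq q. ?c a b * (\<Sum>u\<in>?V. \<Sum>w\<in>?V. ?F a b u w))"
    unfolding sum_distrib_left by (rule sum.cong[OF refl]) (rule sum.swap)
  also have "\<dots> = (\<Sum>a\<in>Zq q. \<Sum>b\<in>Zq q. ?c a b *
      (\<Sum>u\<in>Zq q. \<Sum>w\<in>Zq q. path_corr q \<epsilon> h h' g k (?\<tau> a b) u w * ?S a b u w))"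
    by (simp only: Suc.IH[where T = "?S a b" and \<tau> = "?\<tau> a b" for a b])
  also have "\<dots> = (\<Sum>a\<in>Zq q. \<Sum>b\<in>Zq q. path_corr q \<epsilon> h h' g (Suc k) \<tau> a b * T a b)"
    by (simp add: mult_ac)
  finally show ?case .
qed

section \<open>Signed base-\<open>q\<close> digits and displacement zero\<close>

lemma sum_distinct_powers_eq_0:
  fixes \<delta> :: "'a \<Rightarrow> int"
  assumes "finite I" "inj_on \<epsilon> I" and small: "\<And>i. i \<in> I \<Longrightarrow> \<bar>\<delta> i\<bar> < int q"
    and zero: "(\<Sum>i\<in>I. \<delta> i * int q ^ \<epsilon> i) = 0"
    and "i \<in> I"
  shows "\<delta> i = 0"
proof (rule ccontr)
  assume "\<delta> i \<noteq> 0"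
  define I' where "I' = {i \<in> I. \<delta> i \<noteq> 0}"
  have I': "finite I'" "I' \<noteq> {}"
    using assms(1,5) \<open>\<delta> i \<noteq> 0\<close> by (auto simp: I'_def)
  \<comment> \<open>Among the nonzero digits, the one with least exponent is isolated modulo the
    next power of \<open>q\<close>; hence \<open>q\<close> divides it, although its absolute value
    is below \<open>q\<close>.\<close>
  define l where "l = arg_min_on \<epsilon> I'"
  have l: "l \<in> I'" "\<And>k. k \<in> I' \<Longrightarrow> \<epsilon> l \<le> \<epsilon> k"
    using arg_min_if_finite(1)[OF I'] arg_min_least[OF I'] by (simp_all add: l_def)
  have q: "int q \<noteq> 0"
    using small[OF assms(5)] by linarith
  have "(\<Sum>i\<in>I'. \<delta> i * int q ^ \<epsilon> i) = 0"
    using zero sum.mono_neutral_right[OF assms(1), of I' "\<lambda>i. \<delta> i * int q ^ \<epsilon> i"]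
    by (auto simp: I'_def)
  then have "\<delta> l * int q ^ \<epsilon> l + (\<Sum>i\<in>I' - {l}. \<delta> i * int q ^ \<epsilon> i) = 0"
    using sum.remove[OF I'(1) l(1)] by metis
  moreover have "int q * int q ^ \<epsilon> l dvd (\<Sum>i\<in>I' - {l}. \<delta> i * int q ^ \<epsilon> i)"
  proof (rule dvd_sum)
    fix i assume "i \<in> I' - {l}"
    then have "\<epsilon> l \<le> \<epsilon> i" "\<epsilon> l \<noteq> \<epsilon> i"
      using l inj_onD[OF assms(2)] by (auto simp: I'_def)
    then have "Suc (\<epsilon> l) \<le> \<epsilon> i"
      by simp
    from le_imp_power_dvd[OF this, of "int q"]
    show "int q * int q ^ \<epsilon> l dvd \<delta> i * int q ^ \<epsilon> i"
      by simp
  qed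
  ultimately have "int q * int q ^ \<epsilon> l dvd \<delta> l * int q ^ \<epsilon> l"
    by (metis add_eq_0_iff dvd_minus_iff)
  then have "int q dvd \<delta> l"
    using q by simp
  then show False
    using small[of l] l(1) zdvd_imp_le[of "int q" "\<bar>\<delta> l\<bar>"] by (auto simp: I'_def)
qed

text \<open>A nonzero value needs a pair of paths realising the displacement, whose coordinate
  differences are the signed digits.\<close>

lemma path_corr_support:
  assumes "path_corr q \<epsilon> h h' g k \<tau> a b \<noteq> 0" "a \<in> Zq q" "b \<in> Zq q"
  shows "\<exists>\<delta>. (\<forall>i. \<bar>\<delta> i\<bar> < int q) \<and> \<tau> = (\<Sum>i=1..k + 1. \<delta> i * int q ^ \<epsilon> i)"
  using assms
proof (induction k arbitrary: \<tau> a b)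
  case 0
  then show ?case
    by (intro exI[of _ "\<lambda>_. 0"]) (auto split: if_splits)
next
  case (Suc k)
  let ?\<tau> = "\<tau> - (int b - int a) * int q ^ \<epsilon> (k + 2)"
  obtain u where u: "u \<in> Zq q" and "(\<Sum>w\<in>Zq q.
        chr q (int (h (k + 1) u) * int (h' (k + 1) a) - int (h (k + 1) w) * int (h' (k + 1) b)) *
        path_corr q \<epsilon> h h' g k ?\<tau> u w) \<noteq> 0"
    using Suc.prems(1) by (auto elim: sum.not_neutral_contains_not_neutral)
  then obtain w where w: "w \<in> Zq q" "path_corr q \<epsilon> h h' g k ?\<tau> u w \<noteq> 0"
    by (auto elim: sum.not_neutral_contains_not_neutral)
  from Suc.IH[OF w(2) u w(1)] obtain \<delta> where
    \<delta>: "\<forall>i. \<bar>\<delta> i\<bar> < int q" "?\<tau> = (\<Sum>i=1..k + 1. \<delta> i * int q ^ \<epsilon> i)"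
    by blast
  \<comment> \<open>The new digit is the difference of the end values; index \<open>k + 2\<close>
    lies outside the sum for the shorter path.\<close>
  let ?\<delta> = "\<delta>(k + 2 := int b - int a)"
  have "(\<Sum>i=1..k + 1. ?\<delta> i * int q ^ \<epsilon> i) = ?\<tau>"
    unfolding \<delta>(2) by (rule sum.cong) auto
  then have "\<tau> = (\<Sum>i=1..Suc k + 1. ?\<delta> i * int q ^ \<epsilon> i)"
    by simp
  moreover have "\<bar>?\<delta> i\<bar> < int q" for i
    using \<delta>(1) Suc.prems(2,3) by auto
  ultimately show ?case
    by blast
qed

text \<open>For equal ends the shorter path again has displacement zero, and each diagonal term
  contributes \<open>q ^ k\<close>. For different ends, a nonzero term would expand 0 with the
  nonzero signed digit \<open>b - a\<close>.\<close>

lemma path_corr_0: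
  assumes "inj_on \<epsilon> {1..k + 1}" "a \<in> Zq q" "b \<in> Zq q"
  shows "path_corr q \<epsilon> h h' g k 0 a b = (if a = b then of_nat q ^ k else 0)"
  using assms
proof (induction k arbitrary: a b)
  case (Suc k)
  have inj: "inj_on \<epsilon> {1..k + 1}"
    by (rule inj_on_subset[OF Suc.prems(1)]) auto
  show ?case
  proof (cases "a = b")
    case True
    then show ?thesis
      by (simp add: Suc.IH[OF inj] if_distrib cong: if_cong)
  next
    case False
    let ?\<tau> = "- ((int b - int a) * int q ^ \<epsilon> (k + 2))"
    have "path_corr q \<epsilon> h h' g k ?\<tau> u w = 0" if uw: "u \<in> Zq q" "w \<in> Zq q" for u w
    proof (rule ccontr)
      assume "path_corr q \<epsilon> h h' g k ?\<tau> u w \<noteq> 0"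
      from path_corr_support[OF this uw] obtain \<delta> where
        \<delta>: "\<forall>i. \<bar>\<delta> i\<bar> < int q" "?\<tau> = (\<Sum>i=1..k + 1. \<delta> i * int q ^ \<epsilon> i)"
        by blast
      let ?\<delta> = "\<delta>(k + 2 := int b - int a)"
      have "(\<Sum>i=1..k + 1. ?\<delta> i * int q ^ \<epsilon> i) = ?\<tau>"
        unfolding \<delta>(2) by (rule sum.cong) auto
      then have zero: "(\<Sum>i\<in>{1..Suc k + 1}. ?\<delta> i * int q ^ \<epsilon> i) = 0"
        by simp
      have "\<bar>?\<delta> i\<bar> < int q" for i
        using \<delta>(1) Suc.prems(2,3) by auto
      from sum_distinct_powers_eq_0[OF _ Suc.prems(1) this zero, of "k + 2"]
      show False
        using False by simp
    qed
    then show ?thesis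
      using False by simp
  qed
qed simp

section \<open>The permutation criterion for path correlations\<close>

definition perfect_path_corr :: "nat \<Rightarrow> (nat \<Rightarrow> nat) \<Rightarrow> (nat \<Rightarrow> nat \<Rightarrow> nat) \<Rightarrow> (nat \<Rightarrow> nat \<Rightarrow> nat) \<Rightarrow>
    (nat \<Rightarrow> nat \<Rightarrow> nat) \<Rightarrow> nat \<Rightarrow> bool" where
  "perfect_path_corr q \<epsilon> h h' g k \<longleftrightarrow> (\<forall>\<tau>. \<forall>a\<in>Zq q. \<forall>b\<in>Zq q.
     path_corr q \<epsilon> h h' g k \<tau> a b = (if \<tau> = 0 \<and> a = b then of_nat q ^ k else 0))"

lemma perfect_path_corr_Suc:
  assumes q: "q > 0" and inj: "inj_on \<epsilon> {1..k + 2}"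
    and h: "h (k + 1) \<in> Zq q \<rightarrow> Zq q" and h': "h' (k + 1) \<in> Zq q \<rightarrow> Zq q"
  shows "perfect_path_corr q \<epsilon> h h' g (Suc k) \<longleftrightarrow> perfect_path_corr q \<epsilon> h h' g k \<and>
    bij_betw (h (k + 1)) (Zq q) (Zq q) \<and> bij_betw (h' (k + 1)) (Zq q) (Zq q)"
proof -
  let ?G = "path_corr q \<epsilon> h h' g"
  let ?H = "h (k + 1)" and ?H' = "h' (k + 1)"
  let ?Q = "int q ^ \<epsilon> (k + 2)"
  have inj_k: "inj_on \<epsilon> {1..k + 1}"
    by (rule inj_on_subset[OF inj]) auto
  \<comment> \<open>At displacement zero \<open>path_corr_0\<close> leaves only
    \<open>u = w\<close>, which produces the sums of \<open>permutation_pair_iff\<close>.\<close>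
  have diag: "(\<Sum>u\<in>Zq q. \<Sum>w\<in>Zq q. chr q (int (?H u) * int (?H' a) - int (?H w) * int (?H' b)) * ?G k 0 u w)
      = of_nat q ^ k * (\<Sum>u\<in>Zq q. chr q (int (?H u) * (int (?H' a) - int (?H' b))))" for a b
  proof -
    have "(\<Sum>w\<in>Zq q. chr q (int (?H u) * int (?H' a) - int (?H w) * int (?H' b)) * ?G k 0 u w) =
        of_nat q ^ k * chr q (int (?H u) * (int (?H' a) - int (?H' b)))" if "u \<in> Zq q" for u
    proof -
      have "(\<Sum>w\<in>Zq q. chr q (int (?H u) * int (?H' a) - int (?H w) * int (?H' b)) * ?G k 0 u w) =
          (\<Sum>w\<in>Zq q. if u = w then
            of_nat q ^ k * chr q (int (?H u) * int (?H' a) - int (?H u) * int (?H' b)) else 0)"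
        by (rule sum.cong) (use that in \<open>auto simp: path_corr_0[OF inj_k]\<close>)
      then show ?thesis
        using that by (simp add: right_diff_distrib)
    qed
    then show ?thesis
      by (simp add: sum_distrib_left)
  qed
  show ?thesis
  proof
    assume "perfect_path_corr q \<epsilon> h h' g (Suc k)"
    then have perf: "?G (Suc k) \<tau> a b = (if \<tau> = 0 \<and> a = b then of_nat q ^ Suc k else 0)"
      if "a \<in> Zq q" "b \<in> Zq q" for \<tau> a b
      using that unfolding perfect_path_corr_def by blast
    \<comment> \<open>Adding \<open>(b - a) * ?Q\<close> to the displacement makes the recursion
      evaluate the shorter correlation at exactly \<open>\<sigma>\<close>.\<close>
    have inner: "(\<Sum>u\<in>Zq q. \<Sum>w\<in>Zq q.
        chr q (int (?H u) * int (?H' a) - int (?H w) * int (?H' b)) * ?G k \<sigma> u w) = 0"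
      if "a \<in> Zq q" "b \<in> Zq q" "\<not> (\<sigma> = 0 \<and> a = b)" for a b \<sigma>
    proof -
      have "\<not> (\<sigma> + (int b - int a) * ?Q = 0 \<and> a = b)"
        using that(3) by auto
      then have "?G (Suc k) (\<sigma> + (int b - int a) * ?Q) a b = 0"
        by (simp only: perf[OF that(1,2)] if_False)
      then show ?thesis
        by simp
    qed
    have bij: "bij_betw ?H (Zq q) (Zq q) \<and> bij_betw ?H' (Zq q) (Zq q)"
      unfolding permutation_pair_iff[OF q h h', symmetric]
    proof (intro ballI impI)
      fix a b assume ab: "a \<in> Zq q" "b \<in> Zq q" "a \<noteq> b"
      then show "(\<Sum>u\<in>Zq q. chr q (int (?H u) * (int (?H' a) - int (?H' b)))) = 0"
        using inner[of a b 0] q unfolding diag by simp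
    qed
    have "?G k \<tau> u w = 0" if uw: "u \<in> Zq q" "w \<in> Zq q" and \<tau>: "\<tau> \<noteq> 0" for \<tau> u w
    proof (rule fourier2_zeroD[OF q uw h])
      show "inj_on ?H (Zq q)"
        using bij by (simp add: bij_betw_def)
      fix s t assume "s \<in> Zq q" "t \<in> Zq q"
      \<comment> \<open>Since \<open>?H'\<close> is onto, the pairs of its values exhaust all
        frequencies, as the inversion requires.\<close>
      then have "s \<in> ?H' ` Zq q" "t \<in> ?H' ` Zq q"
        using bij by (simp_all add: bij_betw_def)
      then obtain a b where "a \<in> Zq q" "b \<in> Zq q" "s = ?H' a" "t = ?H' b"
        by blast
      then show "(\<Sum>u\<in>Zq q. \<Sum>w\<in>Zq q. chr q (int (?H u) * int s - int (?H w) * int t) * ?G k \<tau> u w) = 0"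
        using inner \<tau> by blast
    qed
    then have "perfect_path_corr q \<epsilon> h h' g k"
      unfolding perfect_path_corr_def by (metis path_corr_0[OF inj_k])
    with bij show "perfect_path_corr q \<epsilon> h h' g k \<and> bij_betw ?H (Zq q) (Zq q) \<and> bij_betw ?H' (Zq q) (Zq q)"
      by blast
  next
    assume *: "perfect_path_corr q \<epsilon> h h' g k \<and> bij_betw ?H (Zq q) (Zq q) \<and> bij_betw ?H' (Zq q) (Zq q)"
    then have perf: "?G k \<tau> a b = (if \<tau> = 0 \<and> a = b then of_nat q ^ k else 0)"
      if "a \<in> Zq q" "b \<in> Zq q" for \<tau> a b
      using that unfolding perfect_path_corr_def by blast
    have "?G (Suc k) \<tau> a b = 0" if ab: "a \<in> Zq q" "b \<in> Zq q" and \<tau>: "\<tau> \<noteq> 0" for \<tau> a b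
    \<comment> \<open>Either the shorter path has displacement zero, so the ends differ and the
      permutation sum vanishes, or its correlation vanishes by perfection.\<close>
    proof (cases "\<tau> - (int b - int a) * ?Q = 0")
      case True
      then have "a \<noteq> b"
        using \<tau> by auto
      then have "(\<Sum>u\<in>Zq q. chr q (int (?H u) * (int (?H' a) - int (?H' b)))) = 0"
        using * ab unfolding permutation_pair_iff[OF q h h', symmetric] by blast
      then show ?thesis
        unfolding path_corr.simps True diag by simp
    next
      case False
      then show ?thesis
        using ab by (simp add: perf)
    qed
    then show "perfect_path_corr q \<epsilon> h h' g (Suc k)"
      unfolding perfect_path_corr_def using path_corr_0[of \<epsilon> "Suc k"] inj
      by (metis Suc_eq_plus1 add_2_eq_Suc')
  qed
qed

lemma perfect_path_corr_iff:
  assumes "q > 0" "inj_on \<epsilon> {1..k + 1}"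
    and "\<And>i. i \<in> {1..k} \<Longrightarrow> h i \<in> Zq q \<rightarrow> Zq q" "\<And>i. i \<in> {1..k} \<Longrightarrow> h' i \<in> Zq q \<rightarrow> Zq q"
  shows "perfect_path_corr q \<epsilon> h h' g k \<longleftrightarrow>
    (\<forall>i\<in>{1..k}. bij_betw (h i) (Zq q) (Zq q) \<and> bij_betw (h' i) (Zq q) (Zq q))"
  using assms(2-4)
proof (induction k)
  case 0
  show ?case
    by (simp add: perfect_path_corr_def)
next
  case (Suc k)
  have "inj_on \<epsilon> {1..k + 1}"
    by (rule inj_on_subset[OF Suc.prems(1)]) auto
  then have "perfect_path_corr q \<epsilon> h h' g k \<longleftrightarrow>
      (\<forall>i\<in>{1..k}. bij_betw (h i) (Zq q) (Zq q) \<and> bij_betw (h' i) (Zq q) (Zq q))"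
    using Suc.IH Suc.prems(2,3) by simp
  then show ?case
    using perfect_path_corr_Suc[of q \<epsilon> k h h' g] assms(1) Suc.prems
    by (auto simp: atLeastAtMostSuc_conv)
qed

section \<open>Correlations of codes\<close>

lemma bij_betw_vec:
  assumes vec: "\<And>s. s < q ^ k \<Longrightarrow> vec s \<in> Zq_vec q k"
    and num: "\<And>s. s < q ^ k \<Longrightarrow> num (vec s) = s"
  shows "bij_betw vec {..<q ^ k} (Zq_vec q k)"
proof -
  have inj: "inj_on vec {..<q ^ k}"
    by (rule inj_on_inverseI[of _ num]) (simp add: num)
  have "vec ` {..<q ^ k} = Zq_vec q k"
  proof (rule card_subset_eq)
    show "finite (Zq_vec q k)"
      by (rule finite_PiE) simp_all
    show "vec ` {..<q ^ k} \<subseteq> Zq_vec q k"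
      using vec by blast
    show "card (vec ` {..<q ^ k}) = card (Zq_vec q k)"
      by (simp add: card_image[OF inj] card_PiE)
  qed
  with inj show ?thesis
    by (simp add: bij_betw_def)
qed

lemma bij_betw_lsd_vec:
  assumes "q > 0"
  shows "bij_betw (lsd_vec q k) {..<q ^ k} (Zq_vec q k)"
proof (rule bij_betw_vec[where num = "lsd_num q k"])
  show "lsd_vec q k s \<in> Zq_vec q k" for s
    using assms by (simp add: lsd_vec_def)
qed (rule lsd_num_vec)

lemma bij_betw_msd_vec:
  assumes "q > 0"
  shows "bij_betw (msd_vec q k) {..<q ^ k} (Zq_vec q k)"
proof (rule bij_betw_vec[where num = "msd_num q k"])
  show "msd_vec q k s \<in> Zq_vec q k" for s
    using assms by (simp add: msd_vec_def)
qed (rule msd_num_vec)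

text \<open>Summing over all pairs of positions treats both signs of \<open>\<tau>\<close> alike and
  can be reindexed by vectors.\<close>

lemma aperiodic_corr_conv_pairs:
  assumes "length a = L" "length b = L"
  shows "aperiodic_corr a b \<tau> =
    (\<Sum>s<L. \<Sum>r<L. if int r - int s = \<tau> then a ! s * cnj (b ! r) else 0)"
proof (cases "0 \<le> \<tau>")
  case True
  then obtain k where k: "\<tau> = int k"
    using nonneg_int_cases by blast
  have "(\<Sum>s<L. \<Sum>r<L. if int r - int s = \<tau> then a ! s * cnj (b ! r) else 0) =
      (\<Sum>s<L. if s + k < L then a ! s * cnj (b ! (s + k)) else 0)"
  proof (rule sum.cong)
    fix s
    have "(\<Sum>r<L. if int r - int s = \<tau> then a ! s * cnj (b ! r) else 0) =
        (\<Sum>r<L. if r = s + k then a ! s * cnj (b ! r) else 0)"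
      by (rule sum.cong) (auto simp: k)
    then show "(\<Sum>r<L. if int r - int s = \<tau> then a ! s * cnj (b ! r) else 0) =
        (if s + k < L then a ! s * cnj (b ! (s + k)) else 0)"
      by simp
  qed simp
  also have "\<dots> = (\<Sum>s<L - k. a ! s * cnj (b ! (s + k)))"
    by (rule sum.mono_neutral_cong_right) auto
  finally show ?thesis
    using assms k by (simp add: aperiodic_corr_def)
next
  case False
  then obtain k where k: "\<tau> = - int k" "k > 0"
    by (metis linorder_not_le neg_int_cases)
  \<comment> \<open>For negative \<open>\<tau>\<close> the position \<open>s = r + k\<close> is the
    determined one, so its sum is moved inside.\<close>
  have "(\<Sum>s<L. \<Sum>r<L. if int r - int s = \<tau> then a ! s * cnj (b ! r) else 0) =
      (\<Sum>r<L. \<Sum>s<L. if int r - int s = \<tau> then a ! s * cnj (b ! r) else 0)"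
    by (rule sum.swap)
  also have "\<dots> = (\<Sum>r<L. if r + k < L then a ! (r + k) * cnj (b ! r) else 0)"
  proof (rule sum.cong)
    fix r
    have "(\<Sum>s<L. if int r - int s = \<tau> then a ! s * cnj (b ! r) else 0) =
        (\<Sum>s<L. if s = r + k then a ! s * cnj (b ! r) else 0)"
      by (rule sum.cong) (auto simp: k)
    then show "(\<Sum>s<L. if int r - int s = \<tau> then a ! s * cnj (b ! r) else 0) =
        (if r + k < L then a ! (r + k) * cnj (b ! r) else 0)"
      by simp
  qed simp
  also have "\<dots> = (\<Sum>r<L - k. a ! (r + k) * cnj (b ! r))"
    by (rule sum.mono_neutral_cong_right) auto
  finally show ?thesis
    using assms k by (simp add: aperiodic_corr_def)
qed

lemma aperiodic_corr_psi:
  assumes q: "q > 0"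
  shows "aperiodic_corr (psi q m F) (psi q m F') \<tau> =
    (\<Sum>x\<in>Zq_vec q m. \<Sum>y\<in>Zq_vec q m.
      if int (lsd_num q m y) - int (lsd_num q m x) = \<tau> then chr q (int (F x) - int (F' y)) else 0)"
proof -
  let ?H = "\<lambda>x y. if int (lsd_num q m y) - int (lsd_num q m x) = \<tau>
    then chr q (int (F x) - int (F' y)) else 0"
  note reindex = sum.reindex_bij_betw[OF bij_betw_lsd_vec[OF q, of m], symmetric]
  have chr: "xi q ^ k * cnj (xi q ^ l) = chr q (int k - int l)" for k l
    by (simp add: xi_power cnj_chr chr_add[symmetric])
  have "aperiodic_corr (psi q m F) (psi q m F') \<tau> =
      (\<Sum>s<q ^ m. \<Sum>r<q ^ m. ?H (lsd_vec q m s) (lsd_vec q m r))"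
    by (subst aperiodic_corr_conv_pairs[where L = "q ^ m"])
      (auto simp: psi_def chr lsd_num_vec intro!: sum.cong simp del: complex_cnj_power)
  then show ?thesis
    unfolding reindex .
qed

text \<open>Truncated subtraction makes the range of summation empty.\<close>

lemma aperiodic_corr_outside:
  "length a = L \<Longrightarrow> int L \<le> \<bar>\<tau>\<bar> \<Longrightarrow> aperiodic_corr a b \<tau> = 0"
  by (auto simp: aperiodic_corr_def)

text \<open>Codes are labelled by digit vectors instead of numbers, ready for Fourier analysis in
  \<open>t\<close>, \<open>t'\<close> and \<open>d\<close>.\<close>

definition label_corr :: "nat \<Rightarrow> nat \<Rightarrow> nat \<Rightarrow> (nat \<Rightarrow> nat) \<Rightarrow> (nat \<Rightarrow> nat \<Rightarrow> nat) \<Rightarrow>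
    ((nat \<Rightarrow> nat) \<Rightarrow> nat) \<Rightarrow> (nat \<Rightarrow> nat) \<Rightarrow> (nat \<Rightarrow> nat) \<Rightarrow> int \<Rightarrow> complex" where
  "label_corr q m n j \<pi> f t t' \<tau> = (\<Sum>d\<in>Zq_vec q (n + 1).
     aperiodic_corr (psi q m (code_fun q m n j \<pi> f t d)) (psi q m (code_fun q m n j \<pi> f t' d)) \<tau>)"

lemma is_CCC_code_seq_iff:
  assumes q: "q > 0"
  shows "is_CCC (q ^ (n + 1)) (q ^ m) (map (code_seq q m n j \<pi> f) [0..<q ^ (n + 1)]) \<longleftrightarrow>
    (\<forall>t\<in>Zq_vec q (n + 1). \<forall>t'\<in>Zq_vec q (n + 1). \<forall>\<tau>.
      label_corr q m n j \<pi> f t t' \<tau> = (if t = t' \<and> \<tau> = 0 then of_nat (q ^ (n + 1) * q ^ m) else 0))"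
proof -
  let ?v = "msd_vec q (n + 1)" and ?M = "q ^ (n + 1)" and ?L = "q ^ m"
  let ?C = "label_corr q m n j \<pi> f" and ?S = "code_seq q m n j \<pi> f"
  have bij: "bij_betw ?v {..<?M} (Zq_vec q (n + 1))"
    by (rule bij_betw_msd_vec[OF q])
  have corr: "code_corr (?S k) (?S l) \<tau> = ?C (?v k) (?v l) \<tau>" for k l \<tau>
    unfolding label_corr_def sum.reindex_bij_betw[OF bij, symmetric]
    by (simp add: code_corr_def code_seq_def del: power_Suc)
  have outside: "?C t t' \<tau> = 0" if "\<not> \<bar>\<tau>\<bar> < int ?L" for t t' \<tau>
    unfolding label_corr_def
    by (rule sum.neutral) (use that in \<open>simp add: aperiodic_corr_outside[where L = ?L] psi_def\<close>)
  have "is_CCC ?M ?L (map ?S [0..<?M]) \<longleftrightarrow> (\<forall>k<?M. \<forall>l<?M. \<forall>\<tau>. \<bar>\<tau>\<bar> < int ?L \<longrightarrow>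
      code_corr (?S k) (?S l) \<tau> = (if k = l \<and> \<tau> = 0 then of_nat (?M * ?L) else 0))"
    by (auto simp: is_CCC_def code_seq_def psi_def simp del: power_Suc)
  also have "\<dots> \<longleftrightarrow> (\<forall>k<?M. \<forall>l<?M. \<forall>\<tau>.
      ?C (?v k) (?v l) \<tau> = (if ?v k = ?v l \<and> \<tau> = 0 then of_nat (?M * ?L) else 0))"
  proof -
    have inj: "?v k = ?v l \<longleftrightarrow> k = l" if "k < ?M" "l < ?M" for k l
      using that bij by (auto simp: bij_betw_def dest: inj_onD)
    \<comment> \<open>Beyond the range both sides are 0: the length \<open>?L\<close> is positive,
      so \<open>\<tau>\<close> is not 0 there.\<close>
    have bounded: "(\<bar>\<tau>\<bar> < int ?L \<longrightarrow> ?C t t' \<tau> = (if P \<and> \<tau> = 0 then N else 0)) \<longleftrightarrow>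
        ?C t t' \<tau> = (if P \<and> \<tau> = 0 then N else 0)" for t t' \<tau> P N
      using outside[of \<tau> t t'] q by (cases "\<bar>\<tau>\<bar> < int ?L") auto
    show ?thesis
      unfolding corr bounded by (simp only: inj cong: all_cong imp_cong)
  qed
  also have "\<dots> \<longleftrightarrow> (\<forall>t\<in>?v ` {..<?M}. \<forall>t'\<in>?v ` {..<?M}. \<forall>\<tau>.
      ?C t t' \<tau> = (if t = t' \<and> \<tau> = 0 then of_nat (?M * ?L) else 0))"
    by blast
  also have "?v ` {..<?M} = Zq_vec q (n + 1)"
    using bij by (simp only: bij_betw_def)
  finally show ?thesis .
qed

section \<open>Splitting points into their part on \<open>J\<close> and a path outside
  \<open>J\<close>\<close>

locale code_data =
  fixes q m n :: nat and J :: "nat set" and j :: "nat \<Rightarrow> nat"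
    and h h' g \<pi> :: "nat \<Rightarrow> nat \<Rightarrow> nat" and f :: "(nat \<Rightarrow> nat) \<Rightarrow> nat"
  assumes q_pos: "q > 0" and n_less_m: "n < m"
    and J: "J = j ` {1..n}" "J \<subseteq> {1..m}" "card J = n"
    and \<pi>: "\<And>c. c \<in> Zq_vec q n \<Longrightarrow>
      \<pi> (msd_num q n c) \<in> {1..m - n} \<rightarrow> {1..m} - J \<and> inj_on (\<pi> (msd_num q n c)) {1..m - n}"
    and f: "\<And>c x. c \<in> Zq_vec q n \<Longrightarrow> x \<in> Zq_vec q m \<Longrightarrow> (\<forall>i\<in>{1..n}. x (j i) = c i) \<Longrightarrow>
      f x = ((\<Sum>i=1..m - n - 1. h i (x (\<pi> (msd_num q n c) i)) * h' i (x (\<pi> (msd_num q n c) (i + 1)))) +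
        (\<Sum>k=1..m - n. g k (x (\<pi> (msd_num q n c) k))) + msd_num q n c) mod q"
begin

definition perm :: "(nat \<Rightarrow> nat) \<Rightarrow> nat \<Rightarrow> nat" where
  "perm c = \<pi> (msd_num q n c)"

text \<open>The shift by one matches the place value \<open>q ^ (k - 1)\<close> of coordinate
  \<open>k\<close> in \<open>lsd_num\<close>.\<close>

definition expo :: "(nat \<Rightarrow> nat) \<Rightarrow> nat \<Rightarrow> nat" where
  "expo c i = perm c i - 1"

text \<open>
  The point \<open>x\<close> with \<open>x\<^sub>J = c\<close> whose remaining coordinates, read along \<open>\<pi>\<^sub>c\<close>, are \<open>u\<close>.
\<close>

definition point :: "(nat \<Rightarrow> nat) \<Rightarrow> (nat \<Rightarrow> nat) \<Rightarrow> nat \<Rightarrow> nat" where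
  "point c u = (\<lambda>k\<in>{1..m}. if k \<in> J then c (inv_into {1..n} j k)
     else u (inv_into {1..m - n} (perm c) k))"

lemma bij_j: "bij_betw j {1..n} J"
  using J by (simp add: bij_betw_def eq_card_imp_inj_on)

lemma bij_perm:
  assumes "c \<in> Zq_vec q n"
  shows "bij_betw (perm c) {1..m - n} ({1..m} - J)"
proof -
  have inj: "inj_on (perm c) {1..m - n}" and sub: "perm c ` {1..m - n} \<subseteq> {1..m} - J"
    using \<pi>[OF assms] by (auto simp: perm_def)
  have "card ({1..m} - J) = m - n"
    using J finite_subset[OF J(2)] by (simp add: card_Diff_subset)
  then have "perm c ` {1..m - n} = {1..m} - J"
    by (intro card_subset_eq sub) (simp_all add: card_image[OF inj] del: One_nat_def)
  with inj show ?thesis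
    by (simp add: bij_betw_def)
qed

lemma point_j:
  assumes "i \<in> {1..n}"
  shows "point c u (j i) = c i"
proof -
  have "j i \<in> J"
    using J(1) assms by blast
  then show ?thesis
    using assms J(2) bij_betw_inv_into_left[OF bij_j assms] by (auto simp: point_def)
qed

lemma point_perm:
  assumes "c \<in> Zq_vec q n" "i \<in> {1..m - n}"
  shows "point c u (perm c i) = u i"
proof -
  have "perm c i \<in> {1..m} - J"
    using bij_perm[OF assms(1)] assms(2) bij_betwE by blast
  then show ?thesis
    using bij_betw_inv_into_left[OF bij_perm[OF assms(1)] assms(2)] by (simp add: point_def)
qed

lemma point_in_Zq_vec:
  assumes c: "c \<in> Zq_vec q n" and u: "u \<in> Zq_vec q (m - n)"
  shows "point c u \<in> Zq_vec q m"
proof -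
  have "inv_into {1..n} j k \<in> {1..n}" if "k \<in> J" for k
    using that J(1) by (metis inv_into_into)
  then have "c (inv_into {1..n} j k) \<in> Zq q" if "k \<in> J" for k
    using that PiE_mem[OF c] by blast
  moreover have "inv_into {1..m - n} (perm c) k \<in> {1..m - n}" if "k \<in> {1..m} - J" for k
    using that bij_perm[OF c] by (metis bij_betw_def inv_into_into)
  then have "u (inv_into {1..m - n} (perm c) k) \<in> Zq q" if "k \<in> {1..m} - J" for k
    using that PiE_mem[OF u] by blast
  ultimately show ?thesis
    by (simp add: point_def)
qed

lemma label_point:
  assumes "c \<in> Zq_vec q n"
  shows "label q n j (point c u) = msd_num q n c"
  unfolding label_def msd_num_def by (rule sum.cong) (simp_all add: point_j)

text \<open>The coordinates in \<open>J\<close> give back \<open>c\<close>, which fixes the mapping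
  \<open>perm c\<close> along which \<open>u\<close> is read; surjectivity follows by
  counting.\<close>

lemma bij_point:
  "bij_betw (\<lambda>(c, u). point c u) (Zq_vec q n \<times> Zq_vec q (m - n)) (Zq_vec q m)"
proof -
  let ?A = "Zq_vec q n \<times> Zq_vec q (m - n)"
  have inj: "inj_on (\<lambda>(c, u). point c u) ?A"
  proof (rule inj_onI, clarify)
    fix c u c' u' assume c: "c \<in> Zq_vec q n" "c' \<in> Zq_vec q n"
      and u: "u \<in> Zq_vec q (m - n)" "u' \<in> Zq_vec q (m - n)"
      and eq: "point c u = point c' u'"
    have "c i = c' i" if "i \<in> {1..n}" for i
      using point_j[OF that] eq by metis
    then have cc: "c = c'"
      using PiE_ext[OF c] by blast
    have "u i = u' i" if "i \<in> {1..m - n}" for i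
      using point_perm[OF c(1) that] eq cc by metis
    then have "u = u'"
      using PiE_ext[OF u] by blast
    with cc show "c = c' \<and> u = u'"
      by blast
  qed
  have "(\<lambda>(c, u). point c u) ` ?A = Zq_vec q m"
  proof (rule card_subset_eq)
    show "finite (Zq_vec q m)"
      by (rule finite_PiE) simp_all
    show "(\<lambda>(c, u). point c u) ` ?A \<subseteq> Zq_vec q m"
      using point_in_Zq_vec by auto
    show "card ((\<lambda>(c, u). point c u) ` ?A) = card (Zq_vec q m)"
      using n_less_m
      by (simp add: card_image[OF inj] card_cartesian_product card_PiE power_add[symmetric]
          del: One_nat_def)
  qed
  with inj show ?thesis
    by (simp add: bij_betw_def)
qed

lemma sum_points:
  "(\<Sum>x\<in>Zq_vec q m. F x) = (\<Sum>c\<in>Zq_vec q n. \<Sum>u\<in>Zq_vec q (m - n). F (point c u))"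
  unfolding sum.reindex_bij_betw[OF bij_point, symmetric]
  by (simp add: sum.cartesian_product case_prod_unfold)

text \<open>The first summand depends on \<open>c\<close> alone, so it cancels from the displacement
  of two points with the same \<open>c\<close>.\<close>

lemma lsd_num_point:
  assumes "c \<in> Zq_vec q n"
  shows "int (lsd_num q m (point c u)) =
    (\<Sum>i=1..n. int (c i) * int q ^ (j i - 1)) + path_pos q (expo c) (m - n) u"
proof -
  let ?F = "\<lambda>k. int (point c u k) * int q ^ (k - 1)"
  have "int (lsd_num q m (point c u)) = (\<Sum>k\<in>{1..m} - J. ?F k) + (\<Sum>k\<in>J. ?F k)"
    using sum.subset_diff[OF J(2), of ?F] by (simp add: lsd_num_def)
  also have "(\<Sum>k\<in>J. ?F k) = (\<Sum>i=1..n. int (c i) * int q ^ (j i - 1))"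
    by (simp add: sum.reindex_bij_betw[OF bij_j, symmetric] point_j)
  also have "(\<Sum>k\<in>{1..m} - J. ?F k) = path_pos q (expo c) (m - n) u"
    unfolding sum.reindex_bij_betw[OF bij_perm[OF assms], symmetric] path_pos_def expo_def
    by (rule sum.cong) (simp_all add: point_perm[OF assms])
  finally show ?thesis
    by simp
qed

lemma f_point:
  assumes "c \<in> Zq_vec q n" "u \<in> Zq_vec q (m - n)"
  shows "f (point c u) = (path_fun h h' g (m - n - 1) u + msd_num q n c) mod q"
proof -
  have "f (point c u) = ((\<Sum>i=1..m - n - 1. h i (point c u (perm c i)) * h' i (point c u (perm c (i + 1)))) +
        (\<Sum>k=1..m - n. g k (point c u (perm c k))) + msd_num q n c) mod q"
    using f[OF assms(1) point_in_Zq_vec[OF assms]] point_j by (simp add: perm_def)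
  also have "(\<Sum>i=1..m - n - 1. h i (point c u (perm c i)) * h' i (point c u (perm c (i + 1)))) =
      (\<Sum>i=1..m - n - 1. h i (u i) * h' i (u (i + 1)))"
    using n_less_m by (intro sum.cong) (auto simp: point_perm[OF assms(1)])
  also have "(\<Sum>k=1..m - n. g k (point c u (perm c k))) = (\<Sum>k=1..m - n. g k (u k))"
    by (rule sum.cong) (simp_all add: point_perm[OF assms(1)])
  finally show ?thesis
    using n_less_m by (simp add: path_fun_def Suc_diff_Suc)
qed

section \<open>Reduction of code correlations to path correlations\<close>

lemma code_fun_point:
  assumes "c \<in> Zq_vec q n" "u \<in> Zq_vec q (m - n)"
  shows "code_fun q m n j \<pi> f t d (point c u) =
    (path_fun h h' g (m - n - 1) u + msd_num q n c + (\<Sum>i=1..n. (d i + t i) * c i) +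
      d (n + 1) * u 1 + t (n + 1) * u (m - n)) mod q"
proof -
  have "(\<Sum>i=1..n. (d i + t i) * point c u (j i)) = (\<Sum>i=1..n. (d i + t i) * c i)"
    by (rule sum.cong) (simp_all add: point_j)
  moreover have "point c u (perm c 1) = u 1" "point c u (perm c (m - n)) = u (m - n)"
    using n_less_m by (simp_all add: point_perm[OF assms(1)])
  ultimately show ?thesis
    unfolding code_fun_def label_point[OF assms(1)] f_point[OF assms] perm_def
    by (simp add: mod_simps add.assoc)
qed

text \<open>Modulo \<open>q\<close> the difference of exponents is affine in \<open>d\<close>, so
  orthogonality keeps only the pairs for which every coefficient of \<open>d\<close>
  vanishes.\<close>

lemma sum_code_fun:
  assumes c: "c \<in> Zq_vec q n" "c' \<in> Zq_vec q n"
    and u: "u \<in> Zq_vec q (m - n)" and w: "w \<in> Zq_vec q (m - n)"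
  shows "(\<Sum>d\<in>Zq_vec q (n + 1). chr q (int (code_fun q m n j \<pi> f t d (point c u)) -
      int (code_fun q m n j \<pi> f t' d (point c' w)))) =
    (if c = c' \<and> u 1 = w 1
     then of_nat q ^ (n + 1) *
       (chr q (int (path_fun h h' g (m - n - 1) u) - int (path_fun h h' g (m - n - 1) w)) *
        (chr q (\<Sum>i=1..n. (int (t i) - int (t' i)) * int (c i)) *
         chr q (int (t (n + 1)) * int (u (m - n)) - int (t' (n + 1)) * int (w (m - n)))))
     else 0)"
proof -
  \<comment> \<open>\<open>R\<close> collects the terms free of \<open>d\<close>, and
    \<open>z i\<close> below is the coefficient of \<open>d i\<close>.\<close>
  define R where "R = int (path_fun h h' g (m - n - 1) u) - int (path_fun h h' g (m - n - 1) w) +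
    (int (msd_num q n c) - int (msd_num q n c')) +
    ((\<Sum>i=1..n. int (t i) * int (c i)) - (\<Sum>i=1..n. int (t' i) * int (c' i))) +
    (int (t (n + 1)) * int (u (m - n)) - int (t' (n + 1)) * int (w (m - n)))"
  define z where "z i = (if i = n + 1 then int (u 1) - int (w 1) else int (c i) - int (c' i))" for i
  have chr: "chr q (int (code_fun q m n j \<pi> f t d (point c u)) -
      int (code_fun q m n j \<pi> f t' d (point c' w))) =
      chr q R * chr q (\<Sum>i\<in>{1..n + 1}. int (d i) * z i)" for d
  proof -
    let ?A = "\<lambda>t c u. path_fun h h' g (m - n - 1) u + msd_num q n c + (\<Sum>i=1..n. (d i + t i) * c i) +
      d (n + 1) * u 1 + t (n + 1) * u (m - n)"
    have "(\<Sum>i\<in>{1..n + 1}. int (d i) * z i) =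
        (\<Sum>i=1..n. int (d i) * (int (c i) - int (c' i))) + int (d (n + 1)) * (int (u 1) - int (w 1))"
      by (simp add: z_def)
    then have "int (?A t c u) - int (?A t' c' w) = R + (\<Sum>i\<in>{1..n + 1}. int (d i) * z i)"
      unfolding R_def by (simp only:) (simp add: algebra_simps sum.distrib sum_subtractf)
    moreover have "(int (a mod q) - int (b mod q)) mod int q = (int a - int b) mod int q" for a b
      by (simp add: zmod_int mod_simps)
    ultimately show ?thesis
      unfolding chr_add[symmetric] code_fun_point[OF c(1) u] code_fun_point[OF c(2) w]
      by (intro chr_cong[OF q_pos]) (simp only:)
  qed
  have in_Zq: "u 1 \<in> Zq q" "w 1 \<in> Zq q"
    using n_less_m PiE_mem[OF u, of 1] PiE_mem[OF w, of 1] by simp_all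
  have "(\<forall>i\<in>{1..n + 1}. int q dvd z i) \<longleftrightarrow>
      (\<forall>i\<in>{1..n}. int q dvd int (c i) - int (c' i)) \<and> int q dvd int (u 1) - int (w 1)"
    by (auto simp: z_def)
  also have "\<dots> \<longleftrightarrow> (\<forall>i\<in>{1..n}. c i = c' i) \<and> u 1 = w 1"
    using dvd_diff_Zq_iff[OF PiE_mem[OF c(1)] PiE_mem[OF c(2)]] dvd_diff_Zq_iff[OF in_Zq] by simp
  also have "\<dots> \<longleftrightarrow> c = c' \<and> u 1 = w 1"
    using PiE_ext[OF c] by auto
  finally have dvd: "(\<forall>i\<in>{1..n + 1}. int q dvd z i) \<longleftrightarrow> c = c' \<and> u 1 = w 1" .
  have R: "R = (int (path_fun h h' g (m - n - 1) u) - int (path_fun h h' g (m - n - 1) w)) +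
      ((\<Sum>i=1..n. (int (t i) - int (t' i)) * int (c i)) +
       (int (t (n + 1)) * int (u (m - n)) - int (t' (n + 1)) * int (w (m - n))))" if "c = c'"
    using that by (simp add: R_def left_diff_distrib sum_subtractf)
  show ?thesis
    unfolding chr sum_distrib_left[symmetric] sum_chr_PiE[OF q_pos finite_atLeastAtMost] dvd
    by (simp add: R chr_add)
qed

lemma label_corr_eq:
  "label_corr q m n j \<pi> f t t' \<tau> = of_nat q ^ (n + 1) *
    (\<Sum>c\<in>Zq_vec q n. chr q (\<Sum>i=1..n. (int (t i) - int (t' i)) * int (c i)) *
      (\<Sum>a\<in>Zq q. \<Sum>b\<in>Zq q. chr q (int (t (n + 1)) * int a - int (t' (n + 1)) * int b) *
        path_corr q (expo c) h h' g (m - n - 1) \<tau> a b))"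
proof -
  let ?C = "Zq_vec q n" and ?U = "Zq_vec q (m - n)" and ?V = "Zq_vec q m" and ?D = "Zq_vec q (n + 1)"
  let ?F = "\<lambda>t d x. int (code_fun q m n j \<pi> f t d x)"
  let ?l = "\<lambda>x. int (lsd_num q m x)"
  \<comment> \<open>The dependence on \<open>t\<close> and \<open>t'\<close> lies in a factor for
    \<open>c\<close> and in the two end values, which is the kind of weight
    \<open>sum_path_corr\<close> admits.\<close>
  let ?T = "\<lambda>c a b. of_nat q ^ (n + 1) * (chr q (\<Sum>i=1..n. (int (t i) - int (t' i)) * int (c i)) *
    chr q (int (t (n + 1)) * int a - int (t' (n + 1)) * int b))"
  let ?P = "\<lambda>c u w. if u 1 = w 1 \<and> path_pos q (expo c) (m - n) w - path_pos q (expo c) (m - n) u = \<tau>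
    then chr q (int (path_fun h h' g (m - n - 1) u) - int (path_fun h h' g (m - n - 1) w)) *
      ?T c (u (m - n)) (w (m - n)) else 0"
  let ?S = "\<lambda>x y. if ?l y - ?l x = \<tau> then \<Sum>d\<in>?D. chr q (?F t d x - ?F t' d y) else 0"
  have "label_corr q m n j \<pi> f t t' \<tau> = (\<Sum>d\<in>?D. \<Sum>x\<in>?V. \<Sum>y\<in>?V.
      if ?l y - ?l x = \<tau> then chr q (?F t d x - ?F t' d y) else 0)"
    by (simp only: label_corr_def aperiodic_corr_psi[OF q_pos])
  also have "\<dots> = (\<Sum>x\<in>?V. \<Sum>d\<in>?D. \<Sum>y\<in>?V.
      if ?l y - ?l x = \<tau> then chr q (?F t d x - ?F t' d y) else 0)"
    by (rule sum.swap)
  also have "\<dots> = (\<Sum>x\<in>?V. \<Sum>y\<in>?V. \<Sum>d\<in>?D.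
      if ?l y - ?l x = \<tau> then chr q (?F t d x - ?F t' d y) else 0)"
    by (rule sum.cong[OF refl], rule sum.swap)
  also have "\<dots> = (\<Sum>x\<in>?V. \<Sum>y\<in>?V. ?S x y)"
    by (intro sum.cong refl) simp
  also have "\<dots> = (\<Sum>c\<in>?C. \<Sum>u\<in>?U. \<Sum>c'\<in>?C. \<Sum>w\<in>?U. ?S (point c u) (point c' w))"
    by (simp only: sum_points)
  also have "\<dots> = (\<Sum>c\<in>?C. \<Sum>c'\<in>?C. \<Sum>u\<in>?U. \<Sum>w\<in>?U. ?S (point c u) (point c' w))"
    by (rule sum.cong[OF refl], rule sum.swap)
  also have "\<dots> = (\<Sum>c\<in>?C. \<Sum>c'\<in>?C. if c = c' then \<Sum>u\<in>?U. \<Sum>w\<in>?U. ?P c u w else 0)"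
  proof (intro sum.cong refl)
    fix c c' assume c: "c \<in> ?C" "c' \<in> ?C"
    have "?S (point c u) (point c' w) = (if c = c' then ?P c u w else 0)" if "u \<in> ?U" "w \<in> ?U" for u w
      unfolding sum_code_fun[OF c that] lsd_num_point[OF c(1)] lsd_num_point[OF c(2)] by simp
    then show "(\<Sum>u\<in>?U. \<Sum>w\<in>?U. ?S (point c u) (point c' w)) =
        (if c = c' then \<Sum>u\<in>?U. \<Sum>w\<in>?U. ?P c u w else 0)"
      by simp
  qed
  also have "\<dots> = (\<Sum>c\<in>?C. \<Sum>u\<in>?U. \<Sum>w\<in>?U. ?P c u w)"
  proof (rule sum.cong[OF refl])
    fix c assume c: "c \<in> ?C"
    have "finite ?C"
      by (rule finite_PiE) simp_all
    then show "(\<Sum>c'\<in>?C. if c = c' then \<Sum>u\<in>?U. \<Sum>w\<in>?U. ?P c u w else 0) = (\<Sum>u\<in>?U. \<Sum>w\<in>?U. ?P c u w)"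
      using c by simp
  qed
  also have "\<dots> = (\<Sum>c\<in>?C. \<Sum>a\<in>Zq q. \<Sum>b\<in>Zq q. path_corr q (expo c) h h' g (m - n - 1) \<tau> a b * ?T c a b)"
  proof (rule sum.cong[OF refl])
    fix c
    \<comment> \<open>A path through \<open>m - n\<close> coordinates has \<open>m - n - 1\<close>
      edges.\<close>
    have "Suc (m - n - 1) = m - n"
      using n_less_m by simp
    from sum_path_corr[OF q_pos, where k = "m - n - 1" and T = "?T c" and \<epsilon> = "expo c" and \<tau> = \<tau>
        and h = h and h' = h' and g = g, unfolded this]
    show "(\<Sum>u\<in>?U. \<Sum>w\<in>?U. ?P c u w) =
        (\<Sum>a\<in>Zq q. \<Sum>b\<in>Zq q. path_corr q (expo c) h h' g (m - n - 1) \<tau> a b * ?T c a b)" .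
  qed
  finally show ?thesis
    by (simp only: sum_distrib_left mult_ac)
qed

text \<open>Values of \<open>perm c\<close> are at least 1, so the truncated subtraction in
  \<open>expo\<close> keeps them apart. The bound has the shape \<open>k + 1\<close> of the path
  lemmas.\<close>

lemma inj_expo:
  assumes "c \<in> Zq_vec q n"
  shows "inj_on (expo c) {1..m - n - 1 + 1}"
proof (rule inj_onI)
  fix i k assume ik: "i \<in> {1..m - n - 1 + 1}" "k \<in> {1..m - n - 1 + 1}" "expo c i = expo c k"
  then have "i \<in> {1..m - n}" "k \<in> {1..m - n}"
    using n_less_m by auto
  moreover from this have "perm c i \<ge> 1" "perm c k \<ge> 1"
    using bij_betwE[OF bij_perm[OF assms]] by auto
  then have "perm c i = perm c k"
    using ik(3) by (simp add: expo_def)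
  ultimately show "i = k"
    using bij_perm[OF assms] by (auto simp: bij_betw_def dest: inj_onD)
qed

text \<open>In one direction, inversion in the first \<open>n\<close> digits isolates
  \<open>c\<close>, and inversion in the two last digits isolates the ends \<open>a\<close> and
  \<open>b\<close>. The other direction is direct evaluation.\<close>

lemma label_corr_perfect_iff:
  "(\<forall>t\<in>Zq_vec q (n + 1). \<forall>t'\<in>Zq_vec q (n + 1). \<forall>\<tau>.
      label_corr q m n j \<pi> f t t' \<tau> = (if t = t' \<and> \<tau> = 0 then of_nat (q ^ (n + 1) * q ^ m) else 0)) \<longleftrightarrow>
    (\<forall>c\<in>Zq_vec q n. perfect_path_corr q (expo c) h h' g (m - n - 1))"
proof
  let ?G = "\<lambda>c. path_corr q (expo c) h h' g (m - n - 1)"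
  assume perf: "\<forall>t\<in>Zq_vec q (n + 1). \<forall>t'\<in>Zq_vec q (n + 1). \<forall>\<tau>.
      label_corr q m n j \<pi> f t t' \<tau> = (if t = t' \<and> \<tau> = 0 then of_nat (q ^ (n + 1) * q ^ m) else 0)"
  have "?G c \<tau> a b = 0" if c: "c \<in> Zq_vec q n" and ab: "a \<in> Zq q" "b \<in> Zq q" and \<tau>: "\<tau> \<noteq> 0" for c \<tau> a b
  proof (rule fourier2_zeroD[OF q_pos ab, where h = "\<lambda>a. a"])
    fix s r assume sr: "s \<in> Zq q" "r \<in> Zq q"
    show "(\<Sum>a\<in>Zq q. \<Sum>b\<in>Zq q. chr q (int a * int s - int b * int r) * ?G c \<tau> a b) = 0"
    proof (rule fourier_PiE_zeroD[OF q_pos finite_atLeastAtMost c])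
      fix v assume v: "v \<in> Zq_vec q n"
      \<comment> \<open>With zeros in the first \<open>n\<close> digits of \<open>?t'\<close>, the
        differences there are the arbitrary vector \<open>v\<close>; the last digits
        \<open>s\<close> and \<open>r\<close> remain independent.\<close>
      let ?t = "v(n + 1 := s)" and ?t' = "(\<lambda>i\<in>{1..n}. 0)(n + 1 := r)"
      have t: "?t \<in> Zq_vec q (n + 1)" "?t' \<in> Zq_vec q (n + 1)"
        using v sr q_pos fun_upd_in_PiE
        by (auto simp: PiE_iff extensional_def)
      have "label_corr q m n j \<pi> f ?t ?t' \<tau> = 0"
        using perf t \<tau> by simp
      moreover have "(\<Sum>i=1..n. (int (?t i) - int (?t' i)) * int (x i)) = (\<Sum>i\<in>{1..n}. int (v i) * int (x i))" for x
        by (rule sum.cong) auto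
      ultimately show "(\<Sum>x\<in>Zq_vec q n. chr q (\<Sum>i\<in>{1..n}. int (v i) * int (x i)) *
          (\<Sum>a\<in>Zq q. \<Sum>b\<in>Zq q. chr q (int a * int s - int b * int r) * ?G x \<tau> a b)) = 0"
        using q_pos by (simp add: label_corr_eq mult.commute[of "int s"] mult.commute[of "int r"])
    qed
  qed auto
  then show "\<forall>c\<in>Zq_vec q n. perfect_path_corr q (expo c) h h' g (m - n - 1)"
    unfolding perfect_path_corr_def using path_corr_0[OF inj_expo] by (metis (full_types))
next
  let ?G = "\<lambda>c. path_corr q (expo c) h h' g (m - n - 1)"
  assume "\<forall>c\<in>Zq_vec q n. perfect_path_corr q (expo c) h h' g (m - n - 1)"
  then have G: "?G c \<tau> a b = (if \<tau> = 0 \<and> a = b then of_nat q ^ (m - n - 1) else 0)"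
    if "c \<in> Zq_vec q n" "a \<in> Zq q" "b \<in> Zq q" for c \<tau> a b
    using that unfolding perfect_path_corr_def by blast
  show "\<forall>t\<in>Zq_vec q (n + 1). \<forall>t'\<in>Zq_vec q (n + 1). \<forall>\<tau>.
      label_corr q m n j \<pi> f t t' \<tau> = (if t = t' \<and> \<tau> = 0 then of_nat (q ^ (n + 1) * q ^ m) else 0)"
  proof (intro ballI allI)
    fix t t' and \<tau> :: int assume t: "t \<in> Zq_vec q (n + 1)" "t' \<in> Zq_vec q (n + 1)"
    have Zq: "t i \<in> Zq q" "t' i \<in> Zq q" if "i \<in> {1..n + 1}" for i
      using PiE_mem[OF t(1) that] PiE_mem[OF t(2) that] by blast+
    \<comment> \<open>The inner sum has this value for every \<open>c\<close>, so it factors out of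
      the sum over labels.\<close>
    define E where "E = (if \<tau> = 0 \<and> t (n + 1) = t' (n + 1) then of_nat q ^ (m - n) else (0 :: complex))"
    have inner: "(\<Sum>a\<in>Zq q. \<Sum>b\<in>Zq q. chr q (int (t (n + 1)) * int a - int (t' (n + 1)) * int b) *
        ?G c \<tau> a b) = E" if c: "c \<in> Zq_vec q n" for c
    proof -
      have "(\<Sum>a\<in>Zq q. \<Sum>b\<in>Zq q. chr q (int (t (n + 1)) * int a - int (t' (n + 1)) * int b) * ?G c \<tau> a b) =
          (\<Sum>a\<in>Zq q. \<Sum>b\<in>Zq q. if a = b then if \<tau> = 0 then
            chr q (int a * (int (t (n + 1)) - int (t' (n + 1)))) * of_nat q ^ (m - n - 1) else 0 else 0)"
        by (intro sum.cong refl) (simp only: G[OF c], simp add: algebra_simps)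
      also have "\<dots> = (\<Sum>a\<in>Zq q. if \<tau> = 0 then
            chr q (int a * (int (t (n + 1)) - int (t' (n + 1)))) * of_nat q ^ (m - n - 1) else 0)"
        by simp
      also have "\<dots> = (if \<tau> = 0 then (\<Sum>a\<in>Zq q. chr q (int a * (int (t (n + 1)) - int (t' (n + 1))))) *
          of_nat q ^ (m - n - 1) else 0)"
        by (simp add: sum_distrib_right)
      also have "\<dots> = E"
        using n_less_m dvd_diff_Zq_iff[OF Zq, of "n + 1" "n + 1"]
        by (simp add: sum_chr[OF q_pos] E_def power_Suc[symmetric] Suc_diff_Suc del: power_Suc)
      finally show ?thesis .
    qed
    have "label_corr q m n j \<pi> f t t' \<tau> = of_nat q ^ (n + 1) *
        ((\<Sum>c\<in>Zq_vec q n. chr q (\<Sum>i\<in>{1..n}. int (c i) * (int (t i) - int (t' i)))) * E)"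
      by (simp only: label_corr_eq inner sum_distrib_right mult.commute[of "int (t i) - int (t' i)" for i]
          cong: sum.cong)
    also have "\<dots> = of_nat q ^ (n + 1) * ((if \<forall>i\<in>{1..n}. t i = t' i then of_nat q ^ n else 0) * E)"
      using dvd_diff_Zq_iff[OF Zq] by (simp add: sum_chr_PiE[OF q_pos])
    also have "\<dots> = (if t = t' \<and> \<tau> = 0 then of_nat (q ^ (n + 1) * q ^ m) else 0)"
    proof -
      have "t = t' \<longleftrightarrow> (\<forall>i\<in>{1..n + 1}. t i = t' i)"
        using PiE_ext[OF t] by auto
      also have "\<dots> \<longleftrightarrow> (\<forall>i\<in>{1..n}. t i = t' i) \<and> t (n + 1) = t' (n + 1)"
        by (auto simp: atLeastAtMostSuc_conv)
      finally show ?thesis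
        using n_less_m by (auto simp: E_def power_add[symmetric])
    qed
    finally show "label_corr q m n j \<pi> f t t' \<tau> =
        (if t = t' \<and> \<tau> = 0 then of_nat (q ^ (n + 1) * q ^ m) else 0)" .
  qed
qed

end

theorem corollary1:
  fixes q m n :: nat
    and J :: "nat set" and j :: "nat \<Rightarrow> nat"
    and h h' g :: "nat \<Rightarrow> nat \<Rightarrow> nat"
    and \<pi> :: "nat \<Rightarrow> nat \<Rightarrow> nat"
    and f :: "(nat \<Rightarrow> nat) \<Rightarrow> nat"
  assumes "q \<ge> 2" and "m \<ge> 2" and "n < m"
    and "J = j ` {1..n}" and "J \<subseteq> {1..m}" and "card J = n"
    and "\<And>i. i \<in> {1..m - n - 1} \<Longrightarrow> h i \<in> Zq q \<rightarrow> Zq q"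
    and "\<And>i. i \<in> {1..m - n - 1} \<Longrightarrow> h' i \<in> Zq q \<rightarrow> Zq q"
    and "\<And>k. k \<in> {1..m - n} \<Longrightarrow> g k \<in> Zq q \<rightarrow> Zq q"
    and "\<And>c. c \<in> Zq_vec q n \<Longrightarrow>
           \<pi> (msd_num q n c) \<in> {1..m - n} \<rightarrow> {1..m} - J \<and>
           inj_on (\<pi> (msd_num q n c)) {1..m - n}"
    and "\<And>c x. c \<in> Zq_vec q n \<Longrightarrow> x \<in> Zq_vec q m \<Longrightarrow> (\<forall>i\<in>{1..n}. x (j i) = c i) \<Longrightarrow>
           f x = ((\<Sum>i=1..m - n - 1. h i (x (\<pi> (msd_num q n c) i))
                                       * h' i (x (\<pi> (msd_num q n c) (i + 1))))
                  + (\<Sum>k=1..m - n. g k (x (\<pi> (msd_num q n c) k)))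
                  + msd_num q n c) mod q"
  shows "is_CCC (q ^ (n + 1)) (q ^ m) (map (code_seq q m n j \<pi> f) [0..<q ^ (n + 1)])
     \<longleftrightarrow> (\<forall>i\<in>{1..m - n - 1}. bij_betw (h i) (Zq q) (Zq q) \<and> bij_betw (h' i) (Zq q) (Zq q))"
proof -
  have q: "q > 0"
    using assms(1) by simp
  interpret code_data q m n J j h h' g \<pi> f
    by unfold_locales (fact q assms(3-6,10,11))+
  have "perfect_path_corr q (expo c) h h' g (m - n - 1) \<longleftrightarrow>
      (\<forall>i\<in>{1..m - n - 1}. bij_betw (h i) (Zq q) (Zq q) \<and> bij_betw (h' i) (Zq q) (Zq q))"
    if "c \<in> Zq_vec q n" for c
    by (rule perfect_path_corr_iff[OF q inj_expo[OF that] assms(7,8)])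
  \<comment> \<open>A label exists, so the quantifier over \<open>c\<close> is not vacuous and
    yields the condition on \<open>h\<close> and \<open>h'\<close>, which is the same for each
    \<open>c\<close>.\<close>
  moreover have "(\<lambda>i\<in>{1..n}. 0) \<in> Zq_vec q n"
    using q by simp
  ultimately show ?thesis
    unfolding is_CCC_code_seq_iff[OF q] label_corr_perfect_iff by blast
qed

end
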